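(* Let $n=p+q$ with $p\ge q$ and fix $\eta\in\{j,k\}$. For any $n\times n$ quaternionic indefinite unitary matrix $U\in\mathrm{U}(p,q,\mathbb{H})$, there exist two quaternionic unitary matrices $U_p\in\mathrm{U}(p,\mathbb{H})$ and $U_q\in\mathrm{U}(q,\mathbb{H})$, an $n\times n$ complex indefinite unitary matrix $V\in\mathrm{U}(p,q)$, and $q$ unique (up to order and signs) real numbers $\theta_1,\dots,\theta_q$ such that $$U=\begin{bmatrix}U_p&0\\0&U_q\end{bmatrix}\begin{bmatrix}Ch&0&\eta Sh\\0&I_{p-q}&0\\-\eta Sh&0&Ch\end{bmatrix}V.$$
   Context: $\mathbb{H}$ denotes the real quaternions with imaginary units $i,j,k$; complex matrices are regarded as quaternionic matrices with entries in $\mathbb{R}+i\mathbb{R}$. For quaternionic $M$, $(M^D)_{ab}=\overline{M_{ba}}$. With $I_{p,q}=\operatorname{diag}(I_p,-I_q)$: $\mathrm{U}(n,\mathbb{H})=\{G\in\mathbb{H}^{n\times n}:G^DG=I_n\}$, $\mathrm{U}(p,q,\mathbb{H})=\{G\in\mathbb{H}^{n\times n}:G^DI_{p,q}G=I_{p,q}\}$, $\mathrm{U}(p,q)=\{G\in\mathbb{C}^{n\times n}:G^HI_{p,q}G=I_{p,q}\}$ ($^H$ the conjugate transpose). $Ch=\operatorname{diag}(\cosh\theta_1,\dots,\cosh\theta_q)$ and $Sh=\operatorname{diag}(\sinh\theta_1,\dots,\sinh\theta_q)$; the block sizes of the middle factor are $q,\,p-q,\,q$. *)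

theory Defs
  imports
    "HOL-Analysis.Analysis"
    "HOL-Combinatorics.Permutations"
    "Jordan_Normal_Form.Schur_Decomposition"
begin

section \<open>Quaternions\<close>

datatype quat = Quat (qRe: real) (qIm1: real) (qIm2: real) (qIm3: real)

lemma quat_eq_iff:
  "x = y \<longleftrightarrow> qRe x = qRe y \<and> qIm1 x = qIm1 y \<and> qIm2 x = qIm2 y \<and> qIm3 x = qIm3 y"
  by (cases x; cases y) simp

instantiation quat :: real_vector
begin

definition zero_quat :: quat where "0 = Quat 0 0 0 0"

definition plus_quat :: "quat \<Rightarrow> quat \<Rightarrow> quat" where
  "x + y = Quat (qRe x + qRe y) (qIm1 x + qIm1 y) (qIm2 x + qIm2 y) (qIm3 x + qIm3 y)"

definition uminus_quat :: "quat \<Rightarrow> quat" where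
  "- x = Quat (- qRe x) (- qIm1 x) (- qIm2 x) (- qIm3 x)"

definition minus_quat :: "quat \<Rightarrow> quat \<Rightarrow> quat" where
  "x - y = Quat (qRe x - qRe y) (qIm1 x - qIm1 y) (qIm2 x - qIm2 y) (qIm3 x - qIm3 y)"

definition scaleR_quat :: "real \<Rightarrow> quat \<Rightarrow> quat" where
  "scaleR r x = Quat (r * qRe x) (r * qIm1 x) (r * qIm2 x) (r * qIm3 x)"

instance
  by standard
    (simp_all add: quat_eq_iff zero_quat_def plus_quat_def uminus_quat_def minus_quat_def
      scaleR_quat_def algebra_simps)

end

instantiation quat :: real_algebra_1
begin

definition one_quat :: quat where "1 = Quat 1 0 0 0"

definition times_quat :: "quat \<Rightarrow> quat \<Rightarrow> quat" where
  "x * y = Quat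
    (qRe x * qRe y - qIm1 x * qIm1 y - qIm2 x * qIm2 y - qIm3 x * qIm3 y)
    (qRe x * qIm1 y + qIm1 x * qRe y + qIm2 x * qIm3 y - qIm3 x * qIm2 y)
    (qRe x * qIm2 y - qIm1 x * qIm3 y + qIm2 x * qRe y + qIm3 x * qIm1 y)
    (qRe x * qIm3 y + qIm1 x * qIm2 y - qIm2 x * qIm1 y + qIm3 x * qRe y)"

instance
  by standard
    (simp_all add: quat_eq_iff zero_quat_def plus_quat_def one_quat_def times_quat_def
      scaleR_quat_def algebra_simps)

end

definition quat_i :: quat where "quat_i = Quat 0 1 0 0"
definition quat_j :: quat where "quat_j = Quat 0 0 1 0"
definition quat_k :: quat where "quat_k = Quat 0 0 0 1"

lemma quat_units:
  "quat_i * quat_i = - 1" "quat_j * quat_j = - 1" "quat_k * quat_k = - 1"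
  "quat_i * quat_j = quat_k" "quat_j * quat_k = quat_i" "quat_k * quat_i = quat_j"
  "quat_j * quat_i = - quat_k" "quat_k * quat_j = - quat_i" "quat_i * quat_k = - quat_j"
  by (simp_all add: quat_i_def quat_j_def quat_k_def times_quat_def uminus_quat_def one_quat_def)

definition qcnj :: "quat \<Rightarrow> quat" where
  "qcnj x = Quat (qRe x) (- qIm1 x) (- qIm2 x) (- qIm3 x)"

definition quat_of_complex :: "complex \<Rightarrow> quat" where
  "quat_of_complex z = Quat (Re z) (Im z) 0 0"


section \<open>Unitary and indefinite unitary groups\<close>

text \<open>The \<open>mat_adjoint\<close> of the library needs a commutative field, so the quaternionic
  conjugate transpose is defined separately.\<close>

definition quat_adjoint :: "quat mat \<Rightarrow> quat mat" where
  "quat_adjoint M = mat (dim_col M) (dim_row M) (\<lambda>(a, b). qcnj (M $$ (b, a)))"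

definition signature_mat :: "nat \<Rightarrow> nat \<Rightarrow> 'a :: ring_1 mat" where
  "signature_mat p q = four_block_mat (1\<^sub>m p) (0\<^sub>m p q) (0\<^sub>m q p) (- 1\<^sub>m q)"

definition quat_unitary :: "nat \<Rightarrow> quat mat set" where
  "quat_unitary n = {G \<in> carrier_mat n n. quat_adjoint G * G = 1\<^sub>m n}"

definition quat_indefinite_unitary :: "nat \<Rightarrow> nat \<Rightarrow> quat mat set" where
  "quat_indefinite_unitary p q =
    {G \<in> carrier_mat (p + q) (p + q).
      quat_adjoint G * signature_mat p q * G = signature_mat p q}"

definition complex_indefinite_unitary :: "nat \<Rightarrow> nat \<Rightarrow> complex mat set" where
  "complex_indefinite_unitary p q =
    {G \<in> carrier_mat (p + q) (p + q).
      mat_adjoint G * signature_mat p q * G = signature_mat p q}"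


section \<open>The hyperbolic middle factor\<close>

definition append_cols :: "'a :: zero mat \<Rightarrow> 'a mat \<Rightarrow> 'a mat" (infixr \<open>@\<^sub>c\<close> 66) where
  "A @\<^sub>c B = four_block_mat A B (0\<^sub>m 0 (dim_col A)) (0\<^sub>m 0 (dim_col B))"

definition Ch_mat :: "nat \<Rightarrow> (nat \<Rightarrow> real) \<Rightarrow> quat mat" where
  "Ch_mat q \<theta> = mat_diag q (\<lambda>i. of_real (cosh (\<theta> i)))"

definition Sh_mat :: "nat \<Rightarrow> (nat \<Rightarrow> real) \<Rightarrow> quat mat" where
  "Sh_mat q \<theta> = mat_diag q (\<lambda>i. of_real (sinh (\<theta> i)))"

text \<open>Only \<open>\<theta> 0, \<dots>, \<theta> (q - 1)\<close> matter; \<open>q \<le> p\<close> is intended.\<close>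

definition hyperbolic_mat :: "nat \<Rightarrow> nat \<Rightarrow> quat \<Rightarrow> (nat \<Rightarrow> real) \<Rightarrow> quat mat" where
  "hyperbolic_mat p q \<eta> \<theta> =
     (Ch_mat q \<theta> @\<^sub>c 0\<^sub>m q (p - q) @\<^sub>c \<eta> \<cdot>\<^sub>m Sh_mat q \<theta>) @\<^sub>r
     (0\<^sub>m (p - q) q @\<^sub>c 1\<^sub>m (p - q) @\<^sub>c 0\<^sub>m (p - q) q) @\<^sub>r
     (- (\<eta> \<cdot>\<^sub>m Sh_mat q \<theta>) @\<^sub>c 0\<^sub>m q (p - q) @\<^sub>c Ch_mat q \<theta>)"

end

theory Submission
  imports Defs "HOL-Computational_Algebra.Fundamental_Theorem_Algebra"
begin

text \<open>
  Existence. Let \<open>U\<^sub>2\<close> be the bottom \<open>q\<close> rows of \<open>U\<close>. For a quaternionic row \<open>x\<close> of length \<open>q\<close>, let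
  \<open>\<alpha> x \<in> \<complex>\<^sup>n\<close> be the complex part of \<open>x U\<^sub>2\<close>, so that \<open>x U\<^sub>2 = \<alpha> x - \<eta> \<alpha> (\<eta> x)\<close>, and let \<open>h\<close> be the
  Hermitian form of signature \<open>(p, q)\<close>. Since \<open>U\<^sub>2 I\<^bsub>p,q\<^esub> U\<^sub>2\<^sup>D = - I\<close>, the Hermitian form
  \<open>h (\<alpha> x) (\<alpha> y)\<close> on \<open>\<complex>\<^bsup>2q\<^esup>\<close> has eigenvalues in pairs \<open>g\<close>, \<open>- 1 - g\<close> that are exchanged by \<open>x \<mapsto> \<eta> x\<close>.
  Hence there is a quaternionic orthonormal basis \<open>x\<^sub>i\<close> with eigenvalues \<open>g\<^sub>i \<le> - 1 / 2\<close>. The vectors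
  \<open>\<alpha> x\<^sub>i\<close> are \<open>q\<close> orthogonal negative vectors and \<open>\<alpha> (\<eta> x\<^sub>i)\<close> is orthogonal to all of them, so it
  is positive or zero. Therefore \<open>g\<^sub>i = - cosh\<^sup>2 \<theta>\<^sub>i\<close>, and \<open>\<alpha> x\<^sub>i / cosh \<theta>\<^sub>i\<close> and \<open>\<alpha> (\<eta> x\<^sub>i) / sinh \<theta>\<^sub>i\<close>
  are rows of the required \<open>V\<close>, which is completed to a pseudo-orthonormal basis. The remaining left
  factor is pseudo-unitary with prescribed bottom rows, and this forces it to be block diagonal.

  Uniqueness. The complex part of \<open>U\<^sup>D U\<close> is \<open>V\<^sup>H D V\<close> with \<open>D = diag(cosh 2\<theta>, 1, cosh 2\<theta>)\<close>.
  Multiplied by \<open>I\<^bsub>p,q\<^esub>\<close> it is similar to \<open>I\<^bsub>p,q\<^esub> D\<close>, whose negative eigenvalues are \<open>- cosh 2\<theta>\<^sub>i\<close>.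
\<close>

section \<open>Linear algebra over the complex numbers\<close>

lemma homogeneous_system_nontrivial_solution:
  fixes M :: "'a \<Rightarrow> 'b \<Rightarrow> 'c :: field"
  assumes "finite A" "finite B" "card A < card B"
  shows "\<exists>c. (\<exists>b\<in>B. c b \<noteq> 0) \<and> (\<forall>a\<in>A. (\<Sum>b\<in>B. M a b * c b) = 0)"
  using assms
proof (induction A arbitrary: B M rule: finite_induct)
  case empty
  then show ?case by (intro exI[of _ "\<lambda>_. 1"]) (auto simp: card_gt_0_iff)
next
  case (insert a A)
  show ?case
  proof (cases "\<forall>b\<in>B. M a b = 0")
    case True
    with insert.IH[of B M] insert.prems insert.hyps show ?thesis by auto
  next
    case False
    \<comment> \<open>Elimination: the unknown \<open>b0\<close> is solved for in equation
      \<open>a\<close> and substituted into the others, which leaves one equation and one unknown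
      less.\<close>
    then obtain b0 where b0: "b0 \<in> B" "M a b0 \<noteq> 0" by auto
    define B' where "B' = B - {b0}"
    have B': "finite B'" "card A < card B'" "B = insert b0 B'" "b0 \<notin> B'"
      using insert b0 by (auto simp: B'_def)
    obtain c where c: "\<exists>b\<in>B'. c b \<noteq> 0"
      "\<forall>a'\<in>A. (\<Sum>b\<in>B'. (M a' b - M a' b0 * (M a b / M a b0)) * c b) = 0"
      using insert.IH[OF B'(1,2), of "\<lambda>a' b. M a' b - M a' b0 * (M a b / M a b0)"] by auto
    \<comment> \<open>\<open>- s\<close> is the value of the unknown \<open>b0\<close> that equation
      \<open>a\<close> dictates.\<close>
    define s where "s = (\<Sum>b\<in>B'. M a b * c b) / M a b0"
    define c' where "c' = c(b0 := - s)"
    have sum: "(\<Sum>b\<in>B. M x b * c' b) = (\<Sum>b\<in>B'. M x b * c b) - M x b0 * s" for x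
    proof -
      have "(\<Sum>b\<in>B'. M x b * c' b) = (\<Sum>b\<in>B'. M x b * c b)"
        using B'(4) by (intro sum.cong) (auto simp: c'_def)
      then show ?thesis
        using B' by (simp add: c'_def)
    qed
    have "(\<Sum>b\<in>B'. M x b * c b) - M x b0 * s = (\<Sum>b\<in>B'. (M x b - M x b0 * (M a b / M a b0)) * c b)" for x
      by (simp add: s_def sum_divide_distrib sum_distrib_left sum_subtractf algebra_simps)
    with c sum have 1: "(\<Sum>b\<in>B. M x b * c' b) = 0" if "x \<in> A" for x using that by metis
    have 2: "(\<Sum>b\<in>B. M a b * c' b) = 0" using b0 by (simp add: sum s_def)
    from c(1) obtain b where "b \<in> B'" "c b \<noteq> 0" by blast
    then have "b \<in> B" "c' b \<noteq> 0" using B' by (auto simp: c'_def)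
    then show ?thesis using 1 2 by (intro exI[of _ c']) blast
  qed
qed

section \<open>Eigenvectors from annihilating polynomials\<close>

lemma funpow_linear:
  fixes T :: "('n \<Rightarrow> 'c) \<Rightarrow> 'n \<Rightarrow> 'c :: ring"
  assumes "\<And>a b x y. T (\<lambda>i. a * x i + b * y i) = (\<lambda>i. a * T x i + b * T y i)"
  shows "(T ^^ k) (\<lambda>i. a * x i + b * y i) = (\<lambda>i. a * (T ^^ k) x i + b * (T ^^ k) y i)"
  by (induction k) (simp_all add: assms)

text \<open>A root \<mu> of \<open>p\<close> gives \<open>p = (X - \<mu>) r\<close>. Either
  \<open>(T - \<mu>) x\<close> is nonzero on \<open>N\<close>, and then \<open>r\<close> annihilates
  it and has smaller degree, or \<open>x\<close> is itself an eigenvector. Only coordinates in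
  \<open>N\<close> are compared, since the functions may take any values elsewhere; \<open>S\<close>
  describes an invariant subspace in which the eigenvector has to lie.\<close>

lemma eigenvector_of_annihilating_poly:
  fixes T :: "('n \<Rightarrow> complex) \<Rightarrow> 'n \<Rightarrow> complex" and N :: "'n set"
  assumes T_lin: "\<And>a b x y. T (\<lambda>i. a * x i + b * y i) = (\<lambda>i. a * T x i + b * T y i)"
    and S_lin: "\<And>a b x y. S x \<Longrightarrow> S y \<Longrightarrow> S (\<lambda>i. a * x i + b * y i)"
    and S_inv: "\<And>x. S x \<Longrightarrow> S (T x)"
    and p: "p \<noteq> 0" "degree p \<le> m" and x: "S x" "\<exists>i\<in>N. x i \<noteq> 0"
    and ann: "\<And>i. i \<in> N \<Longrightarrow> (\<Sum>k\<le>m. coeff p k * (T ^^ k) x i) = 0"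
  shows "\<exists>y \<mu>. S y \<and> (\<exists>i\<in>N. y i \<noteq> 0) \<and> (\<forall>i\<in>N. T y i = \<mu> * y i)"
  using p x ann
proof (induction m arbitrary: p x)
  case 0
  then obtain i where "i \<in> N" "x i \<noteq> 0" by auto
  with 0 have "coeff p 0 = 0" by fastforce
  with 0 show ?case by (metis le_zero_eq leading_coeff_0_iff)
next
  case (Suc m)
  show ?case
  proof (cases "degree p = 0")
    case True
    then obtain c where "p = [:c:]" by (metis degree_eq_zeroE)
    then have c: "coeff p k = (if k = 0 then c else 0)" "c \<noteq> 0" for k
      using Suc.prems(1) by (auto simp: coeff_pCons split: nat.splits)
    obtain i where "i \<in> N" "x i \<noteq> 0" using Suc.prems by auto
    moreover have "(\<Sum>k\<le>Suc m. coeff p k * (T ^^ k) x i) = c * x i"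
      by (subst sum.remove[of _ 0]) (auto simp: c intro!: sum.neutral)
    ultimately show ?thesis using Suc.prems(5) c by fastforce
  next
    case False
    then have "\<not> constant (poly p)" by (simp add: constant_degree)
    then obtain \<mu> where "poly p \<mu> = 0" using fundamental_theorem_of_algebra by blast
    then obtain r where r: "p = [:- \<mu>, 1:] * r" by (metis poly_eq_0_iff_dvd dvdE)
    with Suc.prems have r0: "r \<noteq> 0" by auto
    have "degree p = Suc (degree r)" using r0 unfolding r by (subst degree_mult_eq) auto
    with Suc.prems have deg: "degree r \<le> m" by simp
    then have rS: "coeff r (Suc m) = 0" by (simp add: coeff_eq_0)
    \<comment> \<open>This is \<open>(T - \<mu>) x\<close>, with the factor 1 kept so that it has
      the shape of the linearity assumptions.\<close>
    define y where "y = (\<lambda>i. 1 * T x i + (- \<mu>) * x i)"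
    have Sy: "S y" unfolding y_def by (intro S_lin S_inv Suc.prems)
    show ?thesis
    proof (cases "\<exists>i\<in>N. y i \<noteq> 0")
      case True
      have "(\<Sum>k\<le>m. coeff r k * (T ^^ k) y i) = (\<Sum>k\<le>Suc m. coeff p k * (T ^^ k) x i)" for i
      proof -
        have Ty: "(T ^^ k) y i = (T ^^ Suc k) x i - \<mu> * (T ^^ k) x i" for k
          unfolding y_def funpow_linear[of T, OF T_lin] by (simp add: funpow_swap1)
        have cp: "coeff p k = (if k = 0 then 0 else coeff r (k - 1)) - \<mu> * coeff r k" for k
          by (cases k) (simp_all add: r)
        have "(\<Sum>k\<le>Suc m. coeff p k * (T ^^ k) x i) =
            (\<Sum>k\<le>Suc m. (if k = 0 then 0 else coeff r (k - 1)) * (T ^^ k) x i) -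
            (\<Sum>k\<le>Suc m. \<mu> * coeff r k * (T ^^ k) x i)"
          unfolding cp by (simp add: sum_subtractf algebra_simps)
        also have "(\<Sum>k\<le>Suc m. (if k = 0 then 0 else coeff r (k - 1)) * (T ^^ k) x i) =
            (\<Sum>k\<le>m. coeff r k * (T ^^ Suc k) x i)"
          by (subst sum.atMost_Suc_shift) simp
        also have "(\<Sum>k\<le>Suc m. \<mu> * coeff r k * (T ^^ k) x i) = (\<Sum>k\<le>m. \<mu> * coeff r k * (T ^^ k) x i)"
          by (simp add: rS)
        finally show ?thesis unfolding Ty by (simp add: sum_subtractf algebra_simps)
      qed
      with Suc.prems have "\<And>i. i \<in> N \<Longrightarrow> (\<Sum>k\<le>m. coeff r k * (T ^^ k) y i) = 0" by simp
      from Suc.IH[OF r0 deg Sy True this] show ?thesis .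
    next
      case False
      then have "\<forall>i\<in>N. T x i = \<mu> * x i" by (auto simp: y_def)
      then show ?thesis using Suc.prems by blast
    qed
  qed
qed

text \<open>The \<open>card N + 1\<close> vectors \<open>x, T x, T^2 x, ...\<close> are linearly
  dependent on the coordinates in \<open>N\<close>, and the coefficients of a dependence form a
  polynomial that annihilates \<open>x\<close>.\<close>

lemma eigenvector_in_invariant_set:
  fixes T :: "('n \<Rightarrow> complex) \<Rightarrow> 'n \<Rightarrow> complex"
  assumes "finite N"
    and T_lin: "\<And>a b x y. T (\<lambda>i. a * x i + b * y i) = (\<lambda>i. a * T x i + b * T y i)"
    and S_lin: "\<And>a b x y. S x \<Longrightarrow> S y \<Longrightarrow> S (\<lambda>i. a * x i + b * y i)"
    and S_inv: "\<And>x. S x \<Longrightarrow> S (T x)"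
    and x: "S x" "\<exists>i\<in>N. x i \<noteq> 0"
  shows "\<exists>y \<mu>. S y \<and> (\<exists>i\<in>N. y i \<noteq> 0) \<and> (\<forall>i\<in>N. T y i = \<mu> * y i)"
proof -
  obtain c where c: "\<exists>k\<in>{..card N}. c k \<noteq> 0"
    "\<forall>i\<in>N. (\<Sum>k\<le>card N. (T ^^ k) x i * c k) = 0"
    using homogeneous_system_nontrivial_solution[OF \<open>finite N\<close>, of "{..card N}" "\<lambda>i k. (T ^^ k) x i"]
    by auto
  define p where "p = (\<Sum>k\<le>card N. monom (c k) k)"
  have cp: "coeff p k = (if k \<le> card N then c k else 0)" for k
    by (simp add: p_def coeff_sum)
  have "p \<noteq> 0" using c(1) cp by (metis atMost_iff coeff_0)
  moreover have "degree p \<le> card N" by (rule degree_le) (simp add: cp)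
  moreover have "(\<Sum>k\<le>card N. coeff p k * (T ^^ k) x i) = 0" if "i \<in> N" for i
    using c(2) that by (simp add: cp mult.commute)
  ultimately show ?thesis
    by (intro eigenvector_of_annihilating_poly[of T S p "card N" x N] assms) auto
qed

section \<open>Diagonal Hermitian forms and orthogonal families\<close>

definition hform :: "(nat \<Rightarrow> real) \<Rightarrow> nat \<Rightarrow> (nat \<Rightarrow> complex) \<Rightarrow> (nat \<Rightarrow> complex) \<Rightarrow> complex" where
  "hform e n x y = (\<Sum>i<n. of_real (e i) * x i * cnj (y i))"

lemma hform_add_left: "hform e n (\<lambda>i. x i + y i) z = hform e n x z + hform e n y z"
  and hform_add_right: "hform e n z (\<lambda>i. x i + y i) = hform e n z x + hform e n z y"
  and hform_scale_left: "hform e n (\<lambda>i. a * x i) z = a * hform e n x z"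
  and hform_scale_right: "hform e n z (\<lambda>i. a * x i) = cnj a * hform e n z x"
  and hform_minus_left: "hform e n (\<lambda>i. - x i) z = - hform e n x z"
  and hform_minus_right: "hform e n z (\<lambda>i. - x i) = - hform e n z x"
  and hform_divide_left: "hform e n (\<lambda>i. x i / a) z = hform e n x z / a"
  and hform_divide_right: "hform e n z (\<lambda>i. x i / a) = hform e n z x / cnj a"
  by (simp_all add: hform_def sum.distrib sum_distrib_left sum_negf sum_divide_distrib algebra_simps)

lemmas hform_linear = hform_add_left hform_add_right hform_scale_left hform_scale_right
  hform_minus_left hform_minus_right hform_divide_left hform_divide_right

lemma hform_cnj: "cnj (hform e n x y) = hform e n y x"
  by (simp add: hform_def algebra_simps)

lemma hform_eq_0_commute: "hform e n x y = 0 \<longleftrightarrow> hform e n y x = 0"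
  by (metis hform_cnj complex_cnj_zero_iff)

lemma hform_sum_left: "hform e n (\<lambda>i. \<Sum>k\<in>A. c k * v k i) z = (\<Sum>k\<in>A. c k * hform e n (v k) z)"
  by (simp add: hform_def sum_distrib_left sum_distrib_right mult_ac)
     (subst sum.swap, simp)

lemma hform_sum_right: "hform e n z (\<lambda>i. \<Sum>k\<in>A. c k * v k i) = (\<Sum>k\<in>A. cnj (c k) * hform e n z (v k))"
  by (simp add: hform_def sum_distrib_left sum_distrib_right mult_ac)
     (subst sum.swap, simp)

lemma hform_self: "hform e n x x = of_real (\<Sum>i<n. e i * (cmod (x i))\<^sup>2)"
  by (simp add: hform_def mult.assoc complex_norm_square[symmetric] del: of_real_power)

lemma hform_self_real: "hform e n x x = of_real (Re (hform e n x x))"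
  by (simp add: hform_self)

lemma hform_cong: "(\<And>i. i < n \<Longrightarrow> x i = x' i) \<Longrightarrow> (\<And>i. i < n \<Longrightarrow> y i = y' i) \<Longrightarrow>
    hform e n x y = hform e n x' y'"
  by (simp add: hform_def)

lemma hform_zero_left: "(\<And>i. i < n \<Longrightarrow> x i = 0) \<Longrightarrow> hform e n x y = 0"
  by (simp add: hform_def)

text \<open>As weights of \<open>hform\<close> these signs give the form of signature (p, q) on
  vectors of length p + q; they are also the diagonal of \<open>signature_mat\<close>.\<close>

definition signature_sign :: "nat \<Rightarrow> nat \<Rightarrow> real" where
  "signature_sign p i = (if i < p then 1 else - 1)"

lemma Re_hform_one_pos:
  assumes "\<exists>i<n. x i \<noteq> 0"
  shows "Re (hform (\<lambda>_. 1) n x x) > 0"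
proof -
  obtain i where "i < n" "x i \<noteq> 0" using assms by blast
  then have "0 < (\<Sum>i<n. (cmod (x i))\<^sup>2)"
    by (intro sum_pos2[of _ i]) auto
  then show ?thesis by (simp add: hform_self)
qed

text \<open>Beside q orthogonal negative vectors, a form with q negative signs has no room for
  another direction that is zero or negative. This fixes the signs of eigenvalues later and allows
  new vectors to be normalised.\<close>

lemma hform_pos_of_orthogonal_negatives:
  assumes v_orth: "\<And>i j. i < q \<Longrightarrow> j < q \<Longrightarrow> i \<noteq> j \<Longrightarrow> hform (signature_sign p) (p + q) (v i) (v j) = 0"
    and v_neg: "\<And>i. i < q \<Longrightarrow> Re (hform (signature_sign p) (p + q) (v i) (v i)) < 0"
    and x_orth: "\<And>i. i < q \<Longrightarrow> hform (signature_sign p) (p + q) x (v i) = 0"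
    and x: "\<exists>t<p + q. x t \<noteq> 0"
  shows "Re (hform (signature_sign p) (p + q) x x) > 0"
proof (rule ccontr)
  \<comment> \<open>A nontrivial combination of the \<open>v i\<close> and \<open>x\<close> has vanishing last \<open>q\<close> coordinates, so that the form
    is nonnegative on it.\<close>
  let ?h = "hform (signature_sign p) (p + q)"
  assume "\<not> ?thesis"
  then have x_le: "Re (?h x x) \<le> 0" by simp
  define w where "w k = (if k < q then v k else x)" for k
  obtain c where c: "\<exists>k\<in>{..q}. c k \<noteq> 0" "\<forall>t\<in>{p..<p + q}. (\<Sum>k\<le>q. w k t * c k) = 0"
    using homogeneous_system_nontrivial_solution[of "{p..<p + q}" "{..q}" "\<lambda>t k. w k t"] by auto
  define y where "y t = (\<Sum>k\<le>q. c k * w k t)" for t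
  have y0: "y t = 0" if "p \<le> t" "t < p + q" for t
    using c(2) that by (auto simp: y_def mult.commute)
  have w_orth: "?h (w k) (w l) = 0" if "k \<le> q" "l \<le> q" "k \<noteq> l" for k l
    using that v_orth x_orth hform_eq_0_commute[of _ _ x] by (auto simp: w_def)
  have hy: "?h y y = (\<Sum>k\<le>q. of_real ((cmod (c k))\<^sup>2) * ?h (w k) (w k))"
  proof -
    have "?h y y = (\<Sum>k\<le>q. c k * (\<Sum>l\<le>q. cnj (c l) * ?h (w k) (w l)))"
      unfolding y_def by (simp only: hform_sum_left hform_sum_right)
    also have "\<dots> = (\<Sum>k\<le>q. c k * (cnj (c k) * ?h (w k) (w k)))"
    proof (intro sum.cong refl arg_cong2[where f = "(*)"])
      fix k assume k: "k \<in> {..q}"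
      show "(\<Sum>l\<le>q. cnj (c l) * ?h (w k) (w l)) = cnj (c k) * ?h (w k) (w k)"
        using k w_orth by (subst sum.remove[of _ k]) (auto intro!: sum.neutral)
    qed
    finally show ?thesis by (simp add: complex_norm_square mult.assoc del: of_real_power)
  qed
  have Rey: "Re (?h y y) = (\<Sum>k\<le>q. (cmod (c k))\<^sup>2 * Re (?h (w k) (w k)))"
    by (simp add: hy)
  have w_le: "Re (?h (w k) (w k)) \<le> 0" if "k \<le> q" for k
    using that v_neg[of k] x_le by (auto simp: w_def)
  have "Re (?h y y) = (\<Sum>i<p + q. signature_sign p i * (cmod (y i))\<^sup>2)"
    by (simp add: hform_self)
  also have "\<dots> = (\<Sum>i<p + q. (cmod (y i))\<^sup>2)"
    by (intro sum.cong) (auto simp: signature_sign_def y0)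
  finally have hy2: "Re (?h y y) = (\<Sum>i<p + q. (cmod (y i))\<^sup>2)" .
  have le: "(\<Sum>k\<le>q. (cmod (c k))\<^sup>2 * Re (?h (w k) (w k))) \<le> 0"
    by (intro sum_nonpos mult_nonneg_nonpos w_le) auto
  then have y_sum: "(\<Sum>i<p + q. (cmod (y i))\<^sup>2) = 0"
    using hy2 Rey sum_nonneg[of "{..<p + q}" "\<lambda>i. (cmod (y i))\<^sup>2"] by simp
  then have y_zero: "y i = 0" if "i < p + q" for i
    using that by (subst (asm) sum_nonneg_eq_0_iff) auto
  have "(\<Sum>k\<le>q. - ((cmod (c k))\<^sup>2 * Re (?h (w k) (w k)))) = 0"
    using y_sum hy2 Rey by (simp add: sum_negf)
  then have *: "(cmod (c k))\<^sup>2 * Re (?h (w k) (w k)) = 0" if "k \<le> q" for k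
    using that w_le by (subst (asm) sum_nonneg_eq_0_iff) (auto simp: mult_nonneg_nonpos)
  \<comment> \<open>Every term of the vanishing sum is zero and the \<open>v k\<close> are strictly
    negative, so only the coefficient of \<open>x\<close> survives.\<close>
  have c0: "c k = 0" if "k < q" for k
    using *[of k] v_neg[of k] that by (auto simp: w_def)
  with c(1) have cq: "c q \<noteq> 0" by (metis atMost_iff nat_less_le)
  have "y t = c q * x t" for t
    unfolding y_def by (subst sum.remove[of _ q]) (auto simp: c0 w_def intro!: sum.neutral)
  with y_zero cq x show False by auto
qed

text \<open>As long as fewer than p + q vectors are present, some nonzero \<open>x\<close> is
  orthogonal to all of them. It is positive because it is orthogonal to the \<open>q\<close>
  negative vectors \<open>v i\<close>, so it can be normalised. \<open>D\<close> holds the positions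
  still to be filled; it shrinks while \<open>I\<close> grows.\<close>

lemma extend_pseudo_orthonormal_family:
  assumes v_orth: "\<And>i j. i < q \<Longrightarrow> j < q \<Longrightarrow>
      hform (signature_sign p) (p + q) (v i) (v j) = (if i = j then - 1 else 0)"
    and "finite D" "I \<inter> D = {}" "I \<union> D \<subseteq> {..<p}"
    and w_orth: "\<And>i j. i \<in> I \<Longrightarrow> j \<in> I \<Longrightarrow>
      hform (signature_sign p) (p + q) (w i) (w j) = (if i = j then 1 else 0)"
    and wv: "\<And>i j. i \<in> I \<Longrightarrow> j < q \<Longrightarrow> hform (signature_sign p) (p + q) (w i) (v j) = 0"
  shows "\<exists>w'. (\<forall>i\<in>I. w' i = w i) \<and>
    (\<forall>i\<in>I \<union> D. \<forall>j\<in>I \<union> D. hform (signature_sign p) (p + q) (w' i) (w' j) = (if i = j then 1 else 0)) \<and>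
    (\<forall>i\<in>I \<union> D. \<forall>j<q. hform (signature_sign p) (p + q) (w' i) (v j) = 0)"
  using assms(2-6)
proof (induction D arbitrary: I w rule: finite_induct)
  case empty
  then show ?case by (intro exI[of _ w]) auto
next
  case (insert d D)
  let ?h = "hform (signature_sign p) (p + q)"
  have finI: "finite I" using insert.prems by (meson finite_lessThan finite_subset le_sup_iff)
  have dI: "d \<notin> I" "d < p" using insert.prems by auto
  have "card I < card {..<p}"
    using insert.prems dI by (intro psubset_card_mono) auto
  \<comment> \<open>The sum type keeps the indices of the \<open>v k\<close> and the
    \<open>w i\<close> apart, so that the two families count as \<open>q + card I\<close>
    equations.\<close>
  then have card: "card (Inl ` {..<q} \<union> Inr ` I :: (nat + nat) set) < card {..<p + q}"
    using finI by (subst card_Un_disjoint) (auto simp: card_image)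
  define u where "u a = (case a of Inl k \<Rightarrow> v k | Inr i \<Rightarrow> w i)" for a :: "nat + nat"
  have fin: "finite (Inl ` {..<q} \<union> Inr ` I :: (nat + nat) set)" using finI by simp
  obtain x where x: "\<exists>t\<in>{..<p + q}. x t \<noteq> 0"
    "\<forall>a\<in>Inl ` {..<q} \<union> Inr ` I. (\<Sum>t<p + q. of_real (signature_sign p t) * cnj (u a t) * x t) = 0"
    using homogeneous_system_nontrivial_solution[OF fin finite_lessThan card,
        of "\<lambda>a t. of_real (signature_sign p t) * cnj (u a t)"] by (elim exE conjE)
  have xu: "?h x (u a) = 0" if "a \<in> Inl ` {..<q} \<union> Inr ` I" for a
  proof -
    have "?h x (u a) = (\<Sum>t<p + q. of_real (signature_sign p t) * cnj (u a t) * x t)"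
      unfolding hform_def by (intro sum.cong) (simp_all add: mult_ac)
    also have "\<dots> = 0" using x(2) that by (rule bspec)
    finally show ?thesis .
  qed
  have xv: "?h x (v k) = 0" if "k < q" for k
    using xu[of "Inl k"] that by (simp add: u_def)
  have xw: "?h x (w i) = 0" if "i \<in> I" for i
    using xu[of "Inr i"] that by (simp add: u_def)
  have pos: "Re (?h x x) > 0"
    by (rule hform_pos_of_orthogonal_negatives[where v = v]) (use x xv v_orth in auto)
  define s where "s = sqrt (Re (?h x x))"
  have s: "s > 0" "?h x x = of_real (s\<^sup>2)"
    using pos hform_self_real[of _ _ x] by (auto simp: s_def)
  define w1 where "w1 = w(d := (\<lambda>t. x t / of_real s))"
  have "\<exists>w'. (\<forall>i\<in>insert d I. w' i = w1 i) \<and>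
    (\<forall>i\<in>insert d I \<union> D. \<forall>j\<in>insert d I \<union> D. ?h (w' i) (w' j) = (if i = j then 1 else 0)) \<and>
    (\<forall>i\<in>insert d I \<union> D. \<forall>j<q. ?h (w' i) (v j) = 0)"
  proof (rule insert.IH)
    show "insert d I \<inter> D = {}" "insert d I \<union> D \<subseteq> {..<p}" using insert by auto
    fix i j assume i: "i \<in> insert d I"
    show "?h (w1 i) (v j) = 0" if "j < q"
      using insert.prems i that xv by (auto simp: w1_def hform_linear)
    assume j: "j \<in> insert d I"
    show "?h (w1 i) (w1 j) = (if i = j then 1 else 0)"
      using insert.prems i j xw s dI hform_eq_0_commute[of _ _ _ x]
      by (auto simp: w1_def hform_linear power2_eq_square)
  qed
  then obtain w' where w': "\<forall>i\<in>insert d I. w' i = w1 i"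
    "\<forall>i\<in>insert d I \<union> D. \<forall>j\<in>insert d I \<union> D. ?h (w' i) (w' j) = (if i = j then 1 else 0)"
    "\<forall>i\<in>insert d I \<union> D. \<forall>j<q. ?h (w' i) (v j) = 0"
    by (elim exE conjE)
  have eq: "I \<union> insert d D = insert d I \<union> D" by simp
  have "\<forall>i\<in>I. w' i = w i"
  proof
    fix i assume "i \<in> I"
    with w'(1) dI show "w' i = w i" by (simp add: w1_def) metis
  qed
  with w'(2,3) show ?case unfolding eq by (intro exI[of _ w'] conjI)
qed

section \<open>Quaternionic spectral theorem\<close>

lemma sum_lessThan_add: "(\<Sum>i<m + n. f i) = (\<Sum>i<m. f i) + (\<Sum>i<n. f (m + i :: nat))"
  for f :: "nat \<Rightarrow> 'a :: comm_monoid_add"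
  by (induction n) (simp_all add: add_ac)

definition lin_comb :: "nat \<Rightarrow> (nat \<Rightarrow> nat \<Rightarrow> complex) \<Rightarrow> (nat \<Rightarrow> complex) \<Rightarrow> nat \<Rightarrow> complex" where
  "lin_comb m R x t = (\<Sum>j<m. x j * R j t)"

text \<open>A vector \<open>x\<close> in \<open>\<complex>\<^bsup>2q\<^esup>\<close> encodes the quaternionic row with entries \<open>x\<^sub>j + x\<^bsub>q+j\<^esub> \<eta>\<close>; the map below
  is left multiplication by \<open>\<eta>\<close>.\<close>

definition quat_flip :: "nat \<Rightarrow> (nat \<Rightarrow> complex) \<Rightarrow> nat \<Rightarrow> complex" where
  "quat_flip q x j = (if j < q then - cnj (x (q + j)) else cnj (x (j - q)))"

abbreviation cinner :: "nat \<Rightarrow> (nat \<Rightarrow> complex) \<Rightarrow> (nat \<Rightarrow> complex) \<Rightarrow> complex" where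
  "cinner \<equiv> hform (\<lambda>_. 1)"

lemma quat_flip_flip: "j < q + q \<Longrightarrow> quat_flip q (quat_flip q x) j = - x j"
  by (auto simp: quat_flip_def)

text \<open>Multiplication by \<eta> is antiunitary: it swaps the two halves of the vector,
  conjugates them and changes the sign of one.\<close>

lemma cinner_quat_flip_flip: "cinner (q + q) (quat_flip q x) (quat_flip q y) = cnj (cinner (q + q) x y)"
  by (simp add: hform_def sum_lessThan_add quat_flip_def add.commute)

lemma cinner_quat_flip_right:
  "cinner (q + q) x (quat_flip q y) = - cnj (cinner (q + q) (quat_flip q x) y)"
proof -
  have "cnj (cinner (q + q) x (quat_flip q y)) = cinner (q + q) (quat_flip q x) (quat_flip q (quat_flip q y))"
    by (simp add: cinner_quat_flip_flip)
  also have "\<dots> = cinner (q + q) (quat_flip q x) (\<lambda>i. - y i)"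
    by (intro hform_cong quat_flip_flip refl)
  also have "\<dots> = - cinner (q + q) (quat_flip q x) y"
    by (simp add: hform_linear)
  finally show ?thesis by (metis complex_cnj_cnj complex_cnj_minus)
qed

text \<open>Each product of an entry with its partner in the other half occurs once with either
  sign. Thus a nonzero row and its \<eta>-multiple give two orthogonal complex directions.\<close>

lemma cinner_quat_flip_self: "cinner (q + q) x (quat_flip q x) = 0"
proof -
  have "cinner (q + q) x (quat_flip q x) =
      (\<Sum>i<q. - (x i * x (q + i))) + (\<Sum>i<q. x (q + i) * x i)"
    by (simp add: hform_def sum_lessThan_add quat_flip_def)
  then show ?thesis by (simp add: sum_negf mult.commute)
qed

lemma lin_comb_linear:
  "lin_comb m R (\<lambda>i. a * x i + b * y i) = (\<lambda>t. a * lin_comb m R x t + b * lin_comb m R y t)"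
  by (simp add: lin_comb_def fun_eq_iff sum.distrib sum_distrib_left algebra_simps)

lemma lin_comb_scale: "lin_comb m R (\<lambda>i. a * x i) = (\<lambda>t. a * lin_comb m R x t)"
  using lin_comb_linear[of m R a x 0 x] by simp

lemma lin_comb_cong: "(\<And>i. i < m \<Longrightarrow> x i = y i) \<Longrightarrow> lin_comb m R x = lin_comb m R y"
  by (auto simp: lin_comb_def fun_eq_iff)

text \<open>Moves the form from \<open>n\<close> coordinates to the \<open>m\<close> coefficients,
  where the vector of values on the \<open>R j\<close> represents it in the standard inner product.
  This provides the operator \<open>T\<close> of the spectral theorem.\<close>

lemma hform_lin_comb_right:
  "hform e n z (lin_comb m R y) = cinner m (\<lambda>j. hform e n z (R j)) y"
proof -
  have "lin_comb m R y = (\<lambda>t. \<Sum>j<m. y j * R j t)" by (simp add: lin_comb_def fun_eq_iff)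
  then show ?thesis
    by (simp only: hform_sum_right) (simp add: hform_def[of "\<lambda>_. 1"] mult.commute)
qed

text \<open>Assumption \<open>E\<close> at \<open>x\<close> and \<open>quat_flip q y\<close> relates
  the form at (\<eta> x, y) to the form at (x, \<eta> y), because flipping twice is -1. The
  eigenvalue \<open>g\<close> of \<open>x\<close> thus turns into \<open>- 1 - g\<close>.\<close>

lemma eigenform_flip:
  assumes E: "\<And>x y. hform e n (lin_comb (q + q) R x) (lin_comb (q + q) R y)
      + cnj (hform e n (lin_comb (q + q) R (quat_flip q x)) (lin_comb (q + q) R (quat_flip q y)))
      = - cinner (q + q) x y"
    and x: "\<And>y. hform e n (lin_comb (q + q) R x) (lin_comb (q + q) R y) = of_real g * cinner (q + q) x y"
  shows "hform e n (lin_comb (q + q) R (quat_flip q x)) (lin_comb (q + q) R y)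
      = of_real (- 1 - g) * cinner (q + q) (quat_flip q x) y"
proof -
  let ?a = "lin_comb (q + q) R" and ?h = "hform e n" and ?s = "quat_flip q"
  have "?a (?s (?s y)) = ?a (\<lambda>i. (- 1) * y i)"
    by (rule lin_comb_cong) (simp add: quat_flip_flip)
  then have "?h (?a (?s x)) (?a (?s (?s y))) = - ?h (?a (?s x)) (?a y)"
    by (simp only: lin_comb_scale) (simp add: hform_linear)
  with E[of x "?s y"] x[of "?s y"]
  have "cnj (?h (?a (?s x)) (?a y)) = (1 + of_real g) * cinner (q + q) x (?s y)"
    by (simp add: algebra_simps)
  then have "cnj (?h (?a (?s x)) (?a y)) = cnj (of_real (- 1 - g) * cinner (q + q) (?s x) y)"
    by (simp add: cinner_quat_flip_right algebra_simps)
  then show ?thesis by (metis complex_cnj_cnj)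
qed

text \<open>Induction on the number of rows. The orthogonal complement of the rows found so far and
  their \<eta>-multiples is invariant and nonzero, so it contains an eigenvector. This vector and
  its \<eta>-multiple have eigenvalues with sum -1, and one with eigenvalue at most -1/2 becomes the
  next row.\<close>

lemma quaternionic_spectral:
  assumes E: "\<And>x y. hform e n (lin_comb (q + q) R x) (lin_comb (q + q) R y)
      + cnj (hform e n (lin_comb (q + q) R (quat_flip q x)) (lin_comb (q + q) R (quat_flip q y)))
      = - cinner (q + q) x y"
    and "m \<le> q"
  shows "\<exists>x g. (\<forall>i<m. \<forall>j<m. cinner (q + q) (x i) (x j) = (if i = j then 1 else 0) \<and>
        cinner (q + q) (x i) (quat_flip q (x j)) = 0) \<and>
      (\<forall>i<m. g i \<le> - 1 / 2 \<and> (\<forall>y. hform e n (lin_comb (q + q) R (x i)) (lin_comb (q + q) R y)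
        = of_real (g i) * cinner (q + q) (x i) y))"
  using \<open>m \<le> q\<close>
proof (induction m)
  case 0
  then show ?case by auto
next
  case (Suc m)
  let ?a = "lin_comb (q + q) R" and ?h = "hform e n" and ?s = "quat_flip q"
  let ?c = "cinner (q + q)"
  obtain x g where
    IH1: "\<forall>i<m. \<forall>j<m. ?c (x i) (x j) = (if i = j then 1 else 0) \<and> ?c (x i) (?s (x j)) = 0"
    and IH2: "\<forall>i<m. g i \<le> - 1 / 2 \<and> (\<forall>y. ?h (?a (x i)) (?a y) = of_real (g i) * ?c (x i) y)"
    using Suc.IH[OF Suc_leD[OF Suc.prems]] by (elim exE conjE)
  have xx: "?c (x i) (x j) = (if i = j then 1 else 0)" and xs: "?c (x i) (?s (x j)) = 0"
    if "i < m" "j < m" for i j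
    using IH1 that by blast+
  have g: "g i \<le> - 1 / 2" and eig: "?h (?a (x i)) (?a y) = of_real (g i) * ?c (x i) y"
    if "i < m" for i y
    using IH2 that by blast+
  have eigs: "?h (?a (?s (x i))) (?a y) = of_real (- 1 - g i) * ?c (?s (x i)) y" if "i < m" for i y
    using eig[OF that] by (intro eigenform_flip[OF E])
  define S where "S y \<longleftrightarrow> (\<forall>i<m. ?c y (x i) = 0 \<and> ?c y (?s (x i)) = 0)" for y
  define T where "T y j = ?h (?a y) (R j)" for y j
  have hT: "?h (?a y) (?a z) = ?c (T y) z" for y z
    unfolding hform_lin_comb_right T_def ..
  have ex: "\<exists>y. S y \<and> (\<exists>j\<in>{..<q + q}. y j \<noteq> 0)"
  proof -
    \<comment> \<open>The \<open>m\<close> rows and their \<eta>-multiples, listed one after the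
      other, give \<open>m + m < q + q\<close> equations.\<close>
    define u where "u k = (if k < m then x k else ?s (x (k - m)))" for k
    obtain y where y: "\<exists>j\<in>{..<q + q}. y j \<noteq> 0" "\<forall>k\<in>{..<m + m}. (\<Sum>j<q + q. cnj (u k j) * y j) = 0"
      using homogeneous_system_nontrivial_solution[of "{..<m + m}" "{..<q + q}" "\<lambda>k j. cnj (u k j)"]
        Suc.prems by auto
    have yu: "?c y (u k) = 0" if "k < m + m" for k
      using y(2) that by (simp add: hform_def mult.commute)
    have "?c y (x i) = 0" "?c y (?s (x i)) = 0" if "i < m" for i
      using yu[of i] yu[of "m + i"] that by (simp_all add: u_def)
    then show ?thesis using y(1) by (auto simp: S_def)
  qed
  then obtain y0 where y0: "S y0" "\<exists>j\<in>{..<q + q}. y0 j \<noteq> 0" by blast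
  have "\<exists>y \<mu>. S y \<and> (\<exists>i\<in>{..<q + q}. y i \<noteq> 0) \<and> (\<forall>i\<in>{..<q + q}. T y i = \<mu> * y i)"
  proof (rule eigenvector_in_invariant_set[where T = T and S = S and x = y0])
    show "finite {..<q + q}" "S y0" "\<exists>j\<in>{..<q + q}. y0 j \<noteq> 0" by (simp_all add: y0)
    show "T (\<lambda>i. a * x i + b * y i) = (\<lambda>i. a * T x i + b * T y i)" for a b x y
      by (simp add: T_def fun_eq_iff lin_comb_linear hform_linear)
    show "S (\<lambda>i. a * x i + b * y i)" if "S x" "S y" for a b x y
      using that by (simp add: S_def hform_linear)
    show "S (T y)" if "S y" for y
    proof -
      have "?c (T y) (x i) = 0" "?c (T y) (?s (x i)) = 0" if i: "i < m" for i
      proof -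
        have 0: "?c (x i) y = 0" "?c (?s (x i)) y = 0"
          using \<open>S y\<close> i by (simp_all add: S_def hform_eq_0_commute[of _ _ _ y])
        \<comment> \<open>The \<open>x i\<close> and their \<eta>-multiples are eigenvectors, so the
          form vanishes between them and \<open>y\<close> because the inner product does; this makes
          the complement invariant.\<close>
        have "?h (?a (x i)) (?a y) = 0" "?h (?a (?s (x i))) (?a y) = 0"
          using 0 by (simp_all add: eig[OF i] eigs[OF i])
        then show "?c (T y) (x i) = 0" "?c (T y) (?s (x i)) = 0"
          by (simp_all add: hT[symmetric] hform_eq_0_commute[of _ _ "?a y"])
      qed
      then show ?thesis by (simp add: S_def)
    qed
  qed
  then obtain y \<mu> where y: "S y" "\<exists>j<q + q. y j \<noteq> 0" and Ty: "\<And>j. j < q + q \<Longrightarrow> T y j = \<mu> * y j"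
    by auto
  have eigy: "?h (?a y) (?a z) = \<mu> * ?c y z" for z
  proof -
    have "?c (T y) z = ?c (\<lambda>j. \<mu> * y j) z" by (intro hform_cong Ty refl)
    then show ?thesis by (simp add: hT hform_linear)
  qed
  have pos: "Re (?c y y) > 0" by (rule Re_hform_one_pos) (fact y)
  define s where "s = sqrt (Re (?c y y))"
  have s: "s > 0" "?c y y = of_real (s\<^sup>2)"
    using pos hform_self_real[of _ _ y] by (auto simp: s_def)
  \<comment> \<open>A Hermitian form is real on the diagonal and \<open>?c y y\<close> is positive,
    so the eigenvalue is real.\<close>
  obtain \<gamma> where \<gamma>: "\<mu> = of_real \<gamma>"
  proof
    have "\<mu> * ?c y y = of_real (Re (?h (?a y) (?a y)))"
      by (metis eigy hform_self_real)
    then show "\<mu> = of_real (Re (?h (?a y) (?a y)) / s\<^sup>2)"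
      using s by (simp add: field_simps)
  qed
  define z where "z = (\<lambda>j. (1 / of_real s) * y j)"
  have zz: "?c z z = 1" using s by (simp only: z_def hform_linear) (simp add: power2_eq_square)
  have Sz: "S z" using y(1) by (simp add: S_def z_def hform_linear)
  have eigz: "?h (?a z) (?a w) = of_real \<gamma> * ?c z w" for w
    unfolding z_def lin_comb_scale using eigy \<gamma> by (simp add: hform_linear)
  have eigsz: "?h (?a (?s z)) (?a w) = of_real (- 1 - \<gamma>) * ?c (?s z) w" for w
    by (intro eigenform_flip[OF E] eigz)
  obtain u \<delta> where u: "?c u u = 1" "S u" "\<delta> \<le> - 1 / 2"
    "\<And>w. ?h (?a u) (?a w) = of_real \<delta> * ?c u w"
  proof (cases "\<gamma> \<le> - 1 / 2")
    case True
    with zz Sz eigz show ?thesis by (intro that[of z \<gamma>])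
  next
    case False
    have "?c (?s z) (x i) = 0 \<and> ?c (?s z) (?s (x i)) = 0" if "i < m" for i
      using Sz that cinner_quat_flip_right[of q z "x i"] by (auto simp: S_def cinner_quat_flip_flip)
    then have "S (?s z)" by (simp add: S_def)
    with False zz eigsz show ?thesis
      by (intro that[of "?s z" "- 1 - \<gamma>"]) (auto simp: cinner_quat_flip_flip)
  qed
  have ux: "?c u (x i) = 0" "?c u (?s (x i)) = 0" "?c (x i) u = 0" "?c (x i) (?s u) = 0"
    if "i < m" for i
  proof -
    show 1: "?c u (x i) = 0" "?c u (?s (x i)) = 0" using u(2) that by (auto simp: S_def)
    then show "?c (x i) u = 0" by (simp add: hform_eq_0_commute[of _ _ _ u])
    have "?c (?s (x i)) u = 0" using 1 by (simp add: hform_eq_0_commute[of _ _ _ u])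
    then show "?c (x i) (?s u) = 0" by (simp add: cinner_quat_flip_right)
  qed
  show ?case
  proof (intro exI[of _ "x(m := u)"] exI[of _ "g(m := \<delta>)"] conjI allI impI)
    fix i j assume ij: "i < Suc m" "j < Suc m"
    show "?c ((x(m := u)) i) ((x(m := u)) j) = (if i = j then 1 else 0)"
      "?c ((x(m := u)) i) (?s ((x(m := u)) j)) = 0"
      using ij xx xs ux u(1) cinner_quat_flip_self[of q u] by (auto simp: less_Suc_eq)
  next
    fix i assume "i < Suc m"
    then show "(g(m := \<delta>)) i \<le> - 1 / 2" using g u by (auto simp: less_Suc_eq)
    fix w show "?h (?a ((x(m := u)) i)) (?a w) = of_real ((g(m := \<delta>)) i) * ?c ((x(m := u)) i) w"
      using \<open>i < Suc m\<close> eig u by (auto simp: less_Suc_eq)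
  qed
qed

section \<open>Quaternions and quaternionic matrices\<close>

lemmas quat_component_defs = zero_quat_def plus_quat_def uminus_quat_def minus_quat_def
  scaleR_quat_def one_quat_def times_quat_def qcnj_def quat_of_complex_def

definition cpart :: "quat \<Rightarrow> complex" where
  "cpart z = Complex (qRe z) (qIm1 z)"

text \<open>The second complex coordinate in \<open>z = cpart z + jpart z * j\<close>, with the
  coefficient on the left.\<close>

definition jpart :: "quat \<Rightarrow> complex" where
  "jpart z = Complex (qIm2 z) (qIm3 z)"

lemma of_real_quat: "of_real r = Quat r 0 0 0"
  by (simp add: of_real_def quat_component_defs)

lemma qcnj_simps [simp]:
  "qcnj 0 = 0" "qcnj 1 = 1" "qcnj (- x) = - qcnj x" "qcnj (x + y) = qcnj x + qcnj y"
  "qcnj (qcnj x) = x" "qcnj (of_real r) = of_real r"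
  "qcnj (quat_of_complex a) = quat_of_complex (cnj a)"
  by (simp_all add: quat_eq_iff quat_component_defs of_real_quat)

lemma qcnj_mult: "qcnj (x * y) = qcnj y * qcnj x"
  by (simp add: quat_eq_iff quat_component_defs algebra_simps)

lemma qcnj_sum: "qcnj (sum f A) = (\<Sum>x\<in>A. qcnj (f x))"
  by (induction A rule: infinite_finite_induct) simp_all

lemma cpart_simps [simp]:
  "cpart 0 = 0" "cpart 1 = 1" "cpart (- x) = - cpart x" "cpart (x + y) = cpart x + cpart y"
  "cpart (x - y) = cpart x - cpart y" "cpart (of_real r) = of_real r"
  "cpart (quat_of_complex a) = a"
  "cpart (quat_of_complex a * x) = a * cpart x" "cpart (x * quat_of_complex a) = cpart x * a"
  "cpart (of_real r * x) = of_real r * cpart x" "cpart (qcnj x) = cnj (cpart x)"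
  by (simp_all add: cpart_def complex_eq_iff quat_component_defs of_real_quat algebra_simps)

lemma cpart_sum: "cpart (sum f A) = (\<Sum>x\<in>A. cpart (f x))"
  by (induction A rule: infinite_finite_induct) simp_all

lemma jpart_add: "jpart (x + y) = jpart x + jpart y"
  by (simp add: jpart_def complex_eq_iff quat_component_defs)

lemma quat_eq_parts_iff: "x = y \<longleftrightarrow> cpart x = cpart y \<and> jpart x = jpart y"
  by (auto simp: quat_eq_iff cpart_def jpart_def)

lemma parts_mult:
  "cpart (x * y) = cpart x * cpart y + jpart x * - cnj (jpart y)"
  "jpart (x * y) = cpart x * jpart y + jpart x * cnj (cpart y)"
  by (simp_all add: cpart_def jpart_def complex_eq_iff quat_component_defs algebra_simps)

lemma quat_of_complex_simps:
  "quat_of_complex 0 = 0" "quat_of_complex 1 = 1"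
  "quat_of_complex (a + b) = quat_of_complex a + quat_of_complex b"
  "quat_of_complex (- a) = - quat_of_complex a"
  "quat_of_complex (a * b) = quat_of_complex a * quat_of_complex b"
  "quat_of_complex (of_real r) = of_real r"
  by (simp_all add: quat_eq_iff quat_component_defs of_real_quat)

lemma quat_of_complex_sum: "quat_of_complex (sum f A) = (\<Sum>x\<in>A. quat_of_complex (f x))"
  by (induction A rule: infinite_finite_induct) (simp_all add: quat_of_complex_simps)

context
  fixes \<eta> :: quat
  assumes eta: "\<eta> \<in> {quat_j, quat_k}"
begin

lemma eta_simps:
  "\<eta> * \<eta> = - 1" "qcnj \<eta> = - \<eta>" "cpart \<eta> = 0" "quat_of_complex a * \<eta> = \<eta> * quat_of_complex (cnj a)"
  using eta by (auto simp: quat_eq_iff quat_component_defs quat_j_def quat_k_def cpart_def complex_eq_iff)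

text \<open>Writing \<open>z = a + b \<eta>\<close> with complex \<open>a\<close> and
  \<open>b\<close> gives \<open>cpart (\<eta> * z) = - cnj b\<close>. Reading off the second
  coordinate in this way treats j and k alike.\<close>

lemma quat_eta_decomp: "z = quat_of_complex (cpart z) - \<eta> * quat_of_complex (cpart (\<eta> * z))"
  using eta by (auto simp: quat_eq_iff quat_component_defs quat_j_def quat_k_def cpart_def)

lemma cpart_eta_eqI: "cpart z = cpart w \<Longrightarrow> cpart (\<eta> * z) = cpart (\<eta> * w) \<Longrightarrow> z = w"
  using quat_eta_decomp[of z] quat_eta_decomp[of w] by simp

text \<open>Splits a quaternionic Gram identity into two complex Hermitian forms, one for the rows
  and one for their \<eta>-multiples.\<close>

lemma cpart_mult_qcnj:
  "cpart (z * qcnj w) = cpart z * cnj (cpart w) + cnj (cpart (\<eta> * z) * cnj (cpart (\<eta> * w)))"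
  using eta by (auto simp: complex_eq_iff quat_component_defs quat_j_def quat_k_def cpart_def algebra_simps)

end

section \<open>Products, adjoints and inverses of quaternionic matrices\<close>

lemma index_mat_mult:
  fixes A :: "'a :: semiring_0 mat"
  assumes "A \<in> carrier_mat n m" "B \<in> carrier_mat m k" "i < n" "j < k"
  shows "(A * B) $$ (i, j) = (\<Sum>l<m. A $$ (i, l) * B $$ (l, j))"
  using assms by (auto simp: scalar_prod_def lessThan_atLeast0 intro!: sum.cong)

lemma quat_adjoint_carrier [simp]: "A \<in> carrier_mat n m \<Longrightarrow> quat_adjoint A \<in> carrier_mat m n"
  by (auto simp: quat_adjoint_def)

lemma quat_adjoint_index:
  "A \<in> carrier_mat n m \<Longrightarrow> i < m \<Longrightarrow> j < n \<Longrightarrow> quat_adjoint A $$ (i, j) = qcnj (A $$ (j, i))"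
  by (auto simp: quat_adjoint_def)

lemma quat_adjoint_adjoint [simp]: "quat_adjoint (quat_adjoint A) = A"
  by (rule eq_matI) (auto simp: quat_adjoint_def)

lemma quat_adjoint_mult:
  assumes A: "A \<in> carrier_mat n m" and B: "B \<in> carrier_mat m k"
  shows "quat_adjoint (A * B) = quat_adjoint B * quat_adjoint A"
proof (rule eq_matI)
  note c = mult_carrier_mat[OF A B] quat_adjoint_carrier[OF A] quat_adjoint_carrier[OF B]
  fix i j assume "i < dim_row (quat_adjoint B * quat_adjoint A)" "j < dim_col (quat_adjoint B * quat_adjoint A)"
  then have ij: "i < k" "j < n" using c by auto
  show "quat_adjoint (A * B) $$ (i, j) = (quat_adjoint B * quat_adjoint A) $$ (i, j)"
    using ij by (simp add: quat_adjoint_index[OF c(1)] index_mat_mult[OF A B] index_mat_mult[OF c(3,2)]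
        quat_adjoint_index[OF A] quat_adjoint_index[OF B] qcnj_sum qcnj_mult)
qed (use A B in \<open>auto simp: quat_adjoint_def\<close>)

text \<open>The library result that one-sided inverses of square matrices are two-sided needs a field.
  It is transferred along the embedding that sends \<open>a + b j\<close> to the complex \<open>2 \<times> 2\<close> matrix with rows
  \<open>(a, b)\<close> and \<open>(- cnj b, cnj a)\<close>.\<close>

definition complexify :: "quat mat \<Rightarrow> complex mat" where
  "complexify M = four_block_mat (map_mat cpart M) (map_mat jpart M)
    (map_mat (\<lambda>z. - cnj (jpart z)) M) (map_mat (\<lambda>z. cnj (cpart z)) M)"

lemma complexify_carrier: "M \<in> carrier_mat n m \<Longrightarrow> complexify M \<in> carrier_mat (n + n) (m + m)"
  unfolding complexify_def by (intro four_block_carrier_mat) simp_all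

lemma complexify_inj:
  assumes A: "A \<in> carrier_mat n m" and B: "B \<in> carrier_mat n m" and eq: "complexify A = complexify B"
  shows "A = B"
proof (rule eq_matI)
  fix i j assume "i < dim_row B" "j < dim_col B"
  then have ij: "i < n" "j < m" using B by auto
  have "complexify A $$ (i, j) = complexify B $$ (i, j)"
    "complexify A $$ (i, m + j) = complexify B $$ (i, m + j)" by (simp_all add: eq)
  then show "A $$ (i, j) = B $$ (i, j)"
    using ij A B by (simp add: complexify_def quat_eq_parts_iff)
qed (use A B in auto)

text \<open>Each of the four blocks of \<open>complexify\<close> obeys a product rule with two
  terms, so one statement serves all of them.\<close>

lemma map_mat_mult_add:
  fixes f g g' h h' :: "'a :: semiring_0 \<Rightarrow> 'b :: semiring_0"
  assumes A: "A \<in> carrier_mat n m" and B: "B \<in> carrier_mat m k"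
    and f0: "f 0 = 0" and f_add: "\<And>x y. f (x + y) = f x + f y"
    and f_mult: "\<And>x y. f (x * y) = g x * g' y + h x * h' y"
  shows "map_mat f (A * B) = map_mat g A * map_mat g' B + map_mat h A * map_mat h' B"
proof (rule eq_matI)
  fix i j assume "i < dim_row (map_mat g A * map_mat g' B + map_mat h A * map_mat h' B)"
    "j < dim_col (map_mat g A * map_mat g' B + map_mat h A * map_mat h' B)"
  then have ij: "i < n" "j < k" using A B by auto
  have f_sum: "f (sum u L) = (\<Sum>l\<in>L. f (u l))" for u and L :: "nat set"
    by (induction L rule: infinite_finite_induct) (simp_all add: f0 f_add)
  have c: "map_mat r A \<in> carrier_mat n m" "map_mat r B \<in> carrier_mat m k" for r :: "'a \<Rightarrow> 'b"
    using A B by simp_all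
  have "(map_mat g A * map_mat g' B + map_mat h A * map_mat h' B) $$ (i, j) =
      (map_mat g A * map_mat g' B) $$ (i, j) + (map_mat h A * map_mat h' B) $$ (i, j)"
    using A B ij by (intro index_add_mat) auto
  also have "\<dots> = (\<Sum>l<m. f (A $$ (i, l) * B $$ (l, j)))"
    using ij A B by (simp only: index_mat_mult[OF c]) (simp add: f_mult sum.distrib)
  also have "\<dots> = f ((A * B) $$ (i, j))"
    by (simp only: index_mat_mult[OF A B ij] f_sum)
  finally show "map_mat f (A * B) $$ (i, j) =
      (map_mat g A * map_mat g' B + map_mat h A * map_mat h' B) $$ (i, j)"
    using A B ij by simp
qed (use A B in auto)

lemma complexify_mult:
  assumes A: "A \<in> carrier_mat n m" and B: "B \<in> carrier_mat m k"
  shows "complexify (A * B) = complexify A * complexify B"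
proof -
  have "complexify A * complexify B = four_block_mat
     (map_mat cpart A * map_mat cpart B + map_mat jpart A * map_mat (\<lambda>z. - cnj (jpart z)) B)
     (map_mat cpart A * map_mat jpart B + map_mat jpart A * map_mat (\<lambda>z. cnj (cpart z)) B)
     (map_mat (\<lambda>z. - cnj (jpart z)) A * map_mat cpart B + map_mat (\<lambda>z. cnj (cpart z)) A * map_mat (\<lambda>z. - cnj (jpart z)) B)
     (map_mat (\<lambda>z. - cnj (jpart z)) A * map_mat jpart B + map_mat (\<lambda>z. cnj (cpart z)) A * map_mat (\<lambda>z. cnj (cpart z)) B)"
    unfolding complexify_def using A B by (intro mult_four_block_mat[where ?n1.0 = m and ?n2.0 = m]) auto
  also have "\<dots> = complexify (A * B)"
    unfolding complexify_def
    by (intro cong_four_block_mat map_mat_mult_add[OF A B, symmetric])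
       (simp_all add: parts_mult jpart_add, simp_all add: jpart_def complex_eq_iff quat_component_defs)
  finally show ?thesis ..
qed

lemma complexify_one: "complexify (1\<^sub>m n) = 1\<^sub>m (n + n)"
  by (rule eq_matI) (auto simp: complexify_def jpart_def complex_eq_iff quat_component_defs cpart_def)

lemma quat_mat_mult_left_right_inverse:
  fixes A B :: "quat mat"
  assumes A: "A \<in> carrier_mat n n" and B: "B \<in> carrier_mat n n" and AB: "A * B = 1\<^sub>m n"
  shows "B * A = 1\<^sub>m n"
proof (rule complexify_inj)
  have "complexify A * complexify B = 1\<^sub>m (n + n)"
    using complexify_mult[OF A B] by (simp add: AB complexify_one)
  then have "complexify B * complexify A = 1\<^sub>m (n + n)"
    by (rule mat_mult_left_right_inverse[OF complexify_carrier[OF A] complexify_carrier[OF B]])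
  then show "complexify (B * A) = complexify (1\<^sub>m n)"
    by (simp add: complexify_mult[OF B A] complexify_one)
qed (use A B in auto)

section \<open>The signature matrix\<close>

lemma signature_mat_eq_mat_diag:
  "signature_mat p q = mat_diag (p + q) (\<lambda>i. of_real (signature_sign p i) :: 'a :: real_algebra_1)"
  by (rule eq_matI) (auto simp: signature_mat_def mat_diag_def signature_sign_def)

lemma signature_mat_carrier [simp]: "signature_mat p q \<in> carrier_mat (p + q) (p + q)"
  by (auto simp: signature_mat_def)

lemma signature_mat_square: "signature_mat p q * signature_mat p q = (1\<^sub>m (p + q) :: 'a :: real_algebra_1 mat)"
proof -
  have "(\<lambda>i. of_real (signature_sign p i) * of_real (signature_sign p i)) = (\<lambda>_. 1 :: 'a)"
    by (auto simp: signature_sign_def)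
  then show ?thesis unfolding signature_mat_eq_mat_diag mat_diag_diag by simp
qed

text \<open>\<open>X J U = J\<close> says that \<open>J X J\<close> is a left inverse of
  \<open>U\<close>; being a right inverse as well, it yields the relation between rows in place of
  columns. With \<open>inv\<close> as an assumption, complex and quaternionic matrices are covered
  together.\<close>

lemma pseudo_unitary_swap:
  fixes X U J :: "'a :: ring_1 mat"
  assumes c: "X \<in> carrier_mat n n" "U \<in> carrier_mat n n" "J \<in> carrier_mat n n"
    and J: "J * J = 1\<^sub>m n" and XJU: "X * J * U = J"
    and inv: "\<And>A B :: 'a mat. A \<in> carrier_mat n n \<Longrightarrow> B \<in> carrier_mat n n \<Longrightarrow> A * B = 1\<^sub>m n \<Longrightarrow> B * A = 1\<^sub>m n"
  shows "U * J * X = J" "(J * X * J) * U = 1\<^sub>m n" "U * (J * X * J) = 1\<^sub>m n"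
proof -
  note [simp] = assoc_mult_mat[where n\<^sub>1 = n and n\<^sub>2 = n and n\<^sub>3 = n and n\<^sub>4 = n]
  show 1: "(J * X * J) * U = 1\<^sub>m n"
    using XJU J c by simp
  show 2: "U * (J * X * J) = 1\<^sub>m n"
    by (rule inv[OF _ _ 1]) (use c in auto)
  have "U * J * X = U * (J * X * J) * J"
    using J c by simp
  also have "\<dots> = J" unfolding 2 using c by simp
  finally show "U * J * X = J" .
qed

section \<open>The hyperbolic factor\<close>

definition hyperbolic_diag :: "nat \<Rightarrow> nat \<Rightarrow> (nat \<Rightarrow> real) \<Rightarrow> nat \<Rightarrow> real" where
  "hyperbolic_diag p q \<theta> i = (if i < q then cosh (\<theta> i) else if i < p then 1 else cosh (\<theta> (i - p)))"

lemma append_cols_simps: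
  "dim_row (A @\<^sub>c B) = dim_row A" "dim_col (A @\<^sub>c B) = dim_col A + dim_col B"
  "i < dim_row A \<Longrightarrow> j < dim_col A + dim_col B \<Longrightarrow>
    (A @\<^sub>c B) $$ (i, j) = (if j < dim_col A then A $$ (i, j) else B $$ (i, j - dim_col A))"
  by (simp_all add: append_cols_def)

lemma append_rows_simps:
  "dim_row (A @\<^sub>r B) = dim_row A + dim_row B" "dim_col (A @\<^sub>r B) = dim_col A"
  "i < dim_row A + dim_row B \<Longrightarrow> j < dim_col A \<Longrightarrow>
    (A @\<^sub>r B) $$ (i, j) = (if i < dim_row A then A $$ (i, j) else B $$ (i - dim_row A, j))"
  by (simp_all add: append_rows_def)

lemma hyperbolic_mat_carrier:
  assumes "q \<le> p" shows "hyperbolic_mat p q \<eta> \<theta> \<in> carrier_mat (p + q) (p + q)"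
proof (rule carrier_matI)
  show "dim_row (hyperbolic_mat p q \<eta> \<theta>) = p + q"
    unfolding hyperbolic_mat_def append_rows_simps append_cols_simps using assms
    by (simp add: Ch_mat_def Sh_mat_def mat_diag_def)
  show "dim_col (hyperbolic_mat p q \<eta> \<theta>) = p + q"
    unfolding hyperbolic_mat_def append_rows_simps append_cols_simps using assms
    by (simp add: Ch_mat_def Sh_mat_def mat_diag_def)
qed

lemma mult_of_real_quat: "x * of_real r = of_real r * (x :: quat)"
  by (simp add: of_real_def)

lemma mult_of_real_left_commute: "x * (of_real r * y) = of_real r * (x * y)" for y :: quat
  by (simp add: of_real_def)

text \<open>Within a row, each of the three terms is supported in a single column, which lets the
  sum in a matrix product collapse.\<close>

lemma hyperbolic_mat_index:
  assumes "q \<le> p" "i < p + q" "j < p + q"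
  shows "hyperbolic_mat p q \<eta> \<theta> $$ (i, j) =
    (if j = i then of_real (hyperbolic_diag p q \<theta> i) else 0) +
    (if i < q \<and> j = p + i then of_real (sinh (\<theta> i)) * \<eta> else 0) -
    (if p \<le> i \<and> j = i - p then of_real (sinh (\<theta> (i - p))) * \<eta> else 0)"
proof -
  define T where "T = Ch_mat q \<theta> @\<^sub>c 0\<^sub>m q (p - q) @\<^sub>c \<eta> \<cdot>\<^sub>m Sh_mat q \<theta>"
  define M where "M = 0\<^sub>m (p - q) q @\<^sub>c 1\<^sub>m (p - q) @\<^sub>c (0\<^sub>m (p - q) q :: quat mat)"
  define B where "B = - (\<eta> \<cdot>\<^sub>m Sh_mat q \<theta>) @\<^sub>c 0\<^sub>m q (p - q) @\<^sub>c Ch_mat q \<theta>"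
  have dims: "dim_row T = q" "dim_row M = p - q" "dim_row B = q"
    "dim_col T = p + q" "dim_col M = p + q" "dim_col B = p + q"
    using assms by (simp_all add: T_def M_def B_def append_cols_simps Ch_mat_def Sh_mat_def mat_diag_def)
  have T: "T $$ (i, j) = (if j < q then (if i = j then of_real (cosh (\<theta> j)) else 0)
      else if j < p then 0 else \<eta> * (if i = j - p then of_real (sinh (\<theta> (j - p))) else 0))"
    if "i < q" "j < p + q" for i j
    using that assms(1) by (simp add: T_def append_cols_simps Ch_mat_def Sh_mat_def mat_diag_def less_diff_conv2)
  have M: "M $$ (i, j) = (if j < q then 0 else if j < p then (if i = j - q then 1 else 0) else 0)"
    if "i < p - q" "j < p + q" for i j
    using that assms(1) by (simp add: M_def append_cols_simps less_diff_conv2)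
  have B: "B $$ (i, j) = (if j < q then - (\<eta> * (if i = j then of_real (sinh (\<theta> j)) else 0))
      else if j < p then 0 else (if i = j - p then of_real (cosh (\<theta> (j - p))) else 0))"
    if "i < q" "j < p + q" for i j
    using that assms(1) by (simp add: B_def append_cols_simps Ch_mat_def Sh_mat_def mat_diag_def less_diff_conv2)
  have MB: "(M @\<^sub>r B) $$ (i, j) = (if i < p - q then M $$ (i, j) else B $$ (i - (p - q), j))"
    if "i < p" "j < p + q" for i j
    using that assms(1) dims by (subst append_rows_simps(3)) auto
  have "hyperbolic_mat p q \<eta> \<theta> = T @\<^sub>r (M @\<^sub>r B)"
    by (simp only: hyperbolic_mat_def T_def M_def B_def)
  also have "(T @\<^sub>r (M @\<^sub>r B)) $$ (i, j) = (if i < q then T $$ (i, j) else (M @\<^sub>r B) $$ (i - q, j))"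
    using assms dims by (subst append_rows_simps(3)) (auto simp: append_rows_simps)
  also have "\<dots> = (if i < q then T $$ (i, j) else if i < p then M $$ (i - q, j) else B $$ (i - p, j))"
    using assms by (auto simp: MB)
  finally have eq: "hyperbolic_mat p q \<eta> \<theta> $$ (i, j) =
    (if i < q then T $$ (i, j) else if i < p then M $$ (i - q, j) else B $$ (i - p, j))" .
  consider "i < q" | "q \<le> i" "i < p" | "p \<le> i" by linarith
  then show ?thesis
  proof cases
    case 1
    then have "i = j - p \<longleftrightarrow> j = p + i" if "\<not> j < p" using that by auto
    then show ?thesis using 1 assms unfolding eq
      by (simp add: T hyperbolic_diag_def mult_of_real_quat[of \<eta>])
  next
    case 2
    then have "i - q = j - q \<longleftrightarrow> j = i" if "\<not> j < q" using that by auto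
    then show ?thesis using 2 assms unfolding eq
      by (simp add: M hyperbolic_diag_def)
  next
    case 3
    then have "i - p = j - p \<longleftrightarrow> j = i" if "\<not> j < p" using that by auto
    moreover have "i - p < q" "i - p < p" "i \<noteq> i - p" using 3 assms by linarith+
    ultimately show ?thesis using 3 assms unfolding eq
      by (simp add: B hyperbolic_diag_def mult_of_real_quat[of \<eta>])
  qed
qed

lemma hyperbolic_mult_index:
  assumes qp: "q \<le> p" and M: "M \<in> carrier_mat (p + q) m" and i: "i < p + q" and t: "t < m"
  shows "(hyperbolic_mat p q \<eta> \<theta> * M) $$ (i, t) =
    of_real (hyperbolic_diag p q \<theta> i) * M $$ (i, t) +
    (if i < q then of_real (sinh (\<theta> i)) * \<eta> * M $$ (p + i, t) else 0) -
    (if p \<le> i then of_real (sinh (\<theta> (i - p))) * \<eta> * M $$ (i - p, t) else 0)"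
proof -
  let ?H = "hyperbolic_mat p q \<eta> \<theta>"
  \<comment> \<open>The test on \<open>l\<close> comes outermost so that each sum collapses. For
    \<open>i < p\<close> the truncated difference \<open>i - p\<close> is 0, but the inner condition
    then makes the term vanish.\<close>
  have split: "?H $$ (i, l) * M $$ (l, t) =
    (if l = i then of_real (hyperbolic_diag p q \<theta> i) * M $$ (i, t) else 0) +
    (if l = p + i then (if i < q then of_real (sinh (\<theta> i)) * \<eta> * M $$ (p + i, t) else 0) else 0) -
    (if l = i - p then (if p \<le> i then of_real (sinh (\<theta> (i - p))) * \<eta> * M $$ (i - p, t) else 0) else 0)"
    if "l < p + q" for l
    unfolding hyperbolic_mat_index[OF qp i that] by (simp add: algebra_simps)
  have "(?H * M) $$ (i, t) = (\<Sum>l<p + q. ?H $$ (i, l) * M $$ (l, t))"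
    by (rule index_mat_mult[OF hyperbolic_mat_carrier[OF qp] M i t])
  also have "\<dots> = (\<Sum>l<p + q.
    (if l = i then of_real (hyperbolic_diag p q \<theta> i) * M $$ (i, t) else 0) +
    (if l = p + i then (if i < q then of_real (sinh (\<theta> i)) * \<eta> * M $$ (p + i, t) else 0) else 0) -
    (if l = i - p then (if p \<le> i then of_real (sinh (\<theta> (i - p))) * \<eta> * M $$ (i - p, t) else 0) else 0))"
    by (intro sum.cong refl split) simp
  finally show ?thesis
    using i by (auto simp: sum.distrib sum_subtractf)
qed

lemma hyperbolic_mat_row_index:
  assumes qp: "q \<le> p" and j: "j < p + q"
  shows "k < q \<Longrightarrow> hyperbolic_mat p q \<eta> \<theta> $$ (k, j) =
      (if j = k then of_real (cosh (\<theta> k)) else if j = p + k then of_real (sinh (\<theta> k)) * \<eta> else 0)"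
    and "k < q \<Longrightarrow> hyperbolic_mat p q \<eta> \<theta> $$ (p + k, j) =
      (if j = p + k then of_real (cosh (\<theta> k)) else if j = k then - (of_real (sinh (\<theta> k)) * \<eta>) else 0)"
    and "q \<le> k \<Longrightarrow> k < p \<Longrightarrow> hyperbolic_mat p q \<eta> \<theta> $$ (k, j) = (if j = k then 1 else 0)"
  using assms by (simp_all add: hyperbolic_mat_index hyperbolic_diag_def)

lemma hyperbolic_mult_row_index:
  assumes qp: "q \<le> p" and M: "M \<in> carrier_mat (p + q) m" and t: "t < m"
  shows "k < q \<Longrightarrow> (hyperbolic_mat p q \<eta> \<theta> * M) $$ (k, t) =
      of_real (cosh (\<theta> k)) * M $$ (k, t) + of_real (sinh (\<theta> k)) * \<eta> * M $$ (p + k, t)"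
    and "k < q \<Longrightarrow> (hyperbolic_mat p q \<eta> \<theta> * M) $$ (p + k, t) =
      of_real (cosh (\<theta> k)) * M $$ (p + k, t) - of_real (sinh (\<theta> k)) * \<eta> * M $$ (k, t)"
    and "q \<le> k \<Longrightarrow> k < p \<Longrightarrow> (hyperbolic_mat p q \<eta> \<theta> * M) $$ (k, t) = M $$ (k, t)"
  using qp t by (simp_all add: hyperbolic_mult_index[OF qp M] hyperbolic_diag_def)

text \<open>These are the three row blocks of the hyperbolic factor; writing bottom rows as
  \<open>p + k\<close> avoids truncated subtraction.\<close>

lemma row_cases:
  fixes i p q :: nat
  assumes "i < p + q" "q \<le> p"
  obtains (top) "i < q" | (middle) "q \<le> i" "i < p" | (bottom) k where "k < q" "i = p + k"
proof -
  consider "i < q" | "q \<le> i" "i < p" | "p \<le> i" by (meson not_less)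
  then show ?thesis
  proof cases
    case 3
    then show ?thesis using assms by (intro bottom[of "i - p"]) auto
  qed (use that in auto)
qed

section \<open>Symmetry and pseudo-unitarity of the hyperbolic factor\<close>

context
  fixes \<eta> :: quat and p q :: nat
  assumes eta: "\<eta> \<in> {quat_j, quat_k}" and qp: "q \<le> p"
begin

text \<open>Conjugation sends \<eta> to -\<eta>, which is exactly the change of sign between the two
  off-diagonal blocks.\<close>

lemma hyperbolic_mat_adjoint: "quat_adjoint (hyperbolic_mat p q \<eta> \<theta>) = hyperbolic_mat p q \<eta> \<theta>"
proof (rule eq_matI)
  note H = hyperbolic_mat_carrier[OF qp, of \<eta> \<theta>]
  fix i j assume "i < dim_row (hyperbolic_mat p q \<eta> \<theta>)" "j < dim_col (hyperbolic_mat p q \<eta> \<theta>)"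
  then have ij: "i < p + q" "j < p + q" using H by auto
  show "quat_adjoint (hyperbolic_mat p q \<eta> \<theta>) $$ (i, j) = hyperbolic_mat p q \<eta> \<theta> $$ (i, j)"
    unfolding quat_adjoint_index[OF H ij] hyperbolic_mat_index[OF qp ij] hyperbolic_mat_index[OF qp ij(2,1)]
    using ij qp by (auto simp: qcnj_mult eta_simps(2)[OF eta] mult_of_real_quat[of \<eta>])
qed (use hyperbolic_mat_carrier[OF qp, of \<eta> \<theta>] in \<open>auto simp: quat_adjoint_def\<close>)

lemma eta_real_simps:
  "of_real r * \<eta> * (of_real s * \<eta>) = - of_real (r * s)"
  "of_real r * \<eta> * of_real s = of_real (r * s) * \<eta>"
  "of_real r * (of_real s * \<eta>) = of_real (r * s) * \<eta>"
proof -
  have 1: "\<eta> * of_real s = of_real s * \<eta>" by (rule mult_of_real_quat)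
  have "of_real r * \<eta> * (of_real s * \<eta>) = of_real r * (\<eta> * of_real s) * \<eta>" by (simp only: mult.assoc)
  also have "\<dots> = of_real r * of_real s * (\<eta> * \<eta>)" unfolding 1 by (simp only: mult.assoc)
  finally show "of_real r * \<eta> * (of_real s * \<eta>) = - of_real (r * s)"
    by (simp add: eta_simps(1)[OF eta])
  show "of_real r * \<eta> * of_real s = of_real (r * s) * \<eta>"
    by (simp only: mult.assoc 1 of_real_mult)
  show "of_real r * (of_real s * \<eta>) = of_real (r * s) * \<eta>"
    by (simp only: mult.assoc of_real_mult)
qed

text \<open>As the factor is self-adjoint, the claim is about a product of three explicit matrices.
  The square of \<eta> is -1, which produces \<open>cosh^2 - sinh^2 = 1\<close> on the
  diagonal.\<close>

lemma hyperbolic_mat_pseudo_unitary: "hyperbolic_mat p q \<eta> \<theta> \<in> quat_indefinite_unitary p q"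
proof -
  let ?H = "hyperbolic_mat p q \<eta> \<theta>"
  let ?J = "signature_mat p q :: quat mat"
  note H = hyperbolic_mat_carrier[OF qp, of \<eta> \<theta>]
  have JH: "?J * ?H \<in> carrier_mat (p + q) (p + q)" using H by (intro mult_carrier_mat) auto
  have JH_index: "(?J * ?H) $$ (i, j) = of_real (signature_sign p i) * ?H $$ (i, j)"
    if "i < p + q" "j < p + q" for i j
    unfolding signature_mat_eq_mat_diag using that by (subst mat_diag_mult_left[OF H]) simp
  have sq: "of_real (cosh x) * of_real (cosh x) = (of_real (sinh x) * of_real (sinh x) + 1 :: quat)" for x :: real
    using arg_cong[OF cosh_square_eq[of x], of "of_real :: real \<Rightarrow> quat"] by (simp add: power2_eq_square)
  have "?H * (?J * ?H) = ?J"
  proof (rule eq_matI)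
    fix i j assume "i < dim_row ?J" "j < dim_col ?J"
    then have ij: "i < p + q" "j < p + q" by (auto simp: signature_mat_def)
    have J: "?J $$ (i, j) = (if i = j then of_real (signature_sign p i) else 0)"
      using ij by (auto simp: signature_mat_eq_mat_diag mat_diag_def)
    from ij(1) qp show "(?H * (?J * ?H)) $$ (i, j) = ?J $$ (i, j)"
    proof (cases rule: row_cases)
      case top
      then have k: "i < p" "p + i < p + q" using qp by auto
      show ?thesis
        unfolding J hyperbolic_mult_row_index(1)[OF qp JH ij(2) top] JH_index[OF ij] JH_index[OF k(2) ij(2)]
        using k by (auto simp: hyperbolic_mat_row_index[OF qp ij(2)] top signature_sign_def eta_real_simps sq mult.commute)
    next
      case middle
      then show ?thesis
        unfolding J hyperbolic_mult_row_index(3)[OF qp JH ij(2) middle] JH_index[OF ij]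
        by (auto simp: hyperbolic_mat_row_index[OF qp ij(2)])
    next
      case (bottom k)
      then have k: "k < p" "k < p + q" "p + k < p + q" using qp by auto
      show ?thesis
        unfolding J[unfolded bottom(2)] bottom(2) hyperbolic_mult_row_index(2)[OF qp JH ij(2) bottom(1)] JH_index[OF k(2) ij(2)] JH_index[OF k(3) ij(2)]
        using k by (auto simp: hyperbolic_mat_row_index[OF qp ij(2)] bottom signature_sign_def eta_real_simps sq mult.commute)
    qed
  qed (use H in \<open>auto simp: signature_mat_def\<close>)
  moreover have "quat_adjoint ?H * ?J * ?H = ?H * (?J * ?H)"
    unfolding hyperbolic_mat_adjoint by (rule assoc_mult_mat[OF H signature_mat_carrier H])
  ultimately show ?thesis using H
    by (simp add: quat_indefinite_unitary_def)
qed

text \<open>In the square the mixed products of cosh and sinh carry a factor \<eta> and so have no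
  complex part, while the diagonal becomes \<open>cosh^2 + sinh^2\<close>, the hyperbolic cosine of
  the doubled angle.\<close>

lemma cpart_hyperbolic_square:
  "map_mat cpart (hyperbolic_mat p q \<eta> \<theta> * hyperbolic_mat p q \<eta> \<theta>) =
    mat_diag (p + q) (\<lambda>i. of_real (hyperbolic_diag p q (\<lambda>i. 2 * \<theta> i) i))"
proof (rule eq_matI)
  let ?H = "hyperbolic_mat p q \<eta> \<theta>"
  let ?D = "mat_diag (p + q) (\<lambda>i. of_real (hyperbolic_diag p q (\<lambda>i. 2 * \<theta> i) i)) :: complex mat"
  note H = hyperbolic_mat_carrier[OF qp, of \<eta> \<theta>]
  fix i j assume "i < dim_row ?D" "j < dim_col ?D"
  then have ij: "i < p + q" "j < p + q" by (auto simp: mat_diag_def)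
  have ce: "cpart (of_real a * of_real b * \<eta>) = 0" for a b
    by (simp add: mult.assoc eta_simps(3)[OF eta])
  have "cpart ((?H * ?H) $$ (i, j)) = (if i = j then of_real (hyperbolic_diag p q (\<lambda>i. 2 * \<theta> i) i) else 0)"
    using ij(1) qp
  proof (cases rule: row_cases)
    case top
    then show ?thesis
      unfolding hyperbolic_mult_row_index(1)[OF qp H ij(2) top]
      using qp by (auto simp: hyperbolic_mat_row_index[OF qp ij(2)] hyperbolic_diag_def eta_real_simps
          eta_simps(3)[OF eta] cosh_double power2_eq_square ce)
  next
    case middle
    then show ?thesis
      unfolding hyperbolic_mult_row_index(3)[OF qp H ij(2) middle]
      by (auto simp: hyperbolic_mat_row_index[OF qp ij(2)] hyperbolic_diag_def)
  next
    case (bottom k)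
    then show ?thesis
      unfolding bottom(2) hyperbolic_mult_row_index(2)[OF qp H ij(2) bottom(1)]
      using qp by (auto simp: hyperbolic_mat_row_index[OF qp ij(2)] hyperbolic_diag_def eta_real_simps
          eta_simps(3)[OF eta] cosh_double power2_eq_square ce)
  qed
  then show "map_mat cpart (?H * ?H) $$ (i, j) = ?D $$ (i, j)"
    using H ij by (auto simp: mat_diag_def)
qed (use hyperbolic_mat_carrier[OF qp, of \<eta> \<theta>] in \<open>auto simp: mat_diag_def\<close>)

end

section \<open>Uniqueness of the angles\<close>

lemma mat_adjoint_carrier: "A \<in> carrier_mat n m \<Longrightarrow> mat_adjoint A \<in> carrier_mat m n"
  by (auto simp: mat_adjoint_def)

lemma mat_adjoint_index:
  fixes A :: "complex mat"
  assumes "A \<in> carrier_mat n m" "i < m" "j < n"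
  shows "mat_adjoint A $$ (i, j) = cnj (A $$ (j, i))"
  using assms by (auto simp: mat_adjoint_def mat_of_rows_index)

lemma quat_adjoint_map_quat_of_complex:
  assumes V: "V \<in> carrier_mat n m"
  shows "quat_adjoint (map_mat quat_of_complex V) = map_mat quat_of_complex (mat_adjoint V)"
proof (rule eq_matI)
  have V': "map_mat quat_of_complex V \<in> carrier_mat n m" using V by simp
  note A = mat_adjoint_carrier[OF V]
  fix i j assume "i < dim_row (map_mat quat_of_complex (mat_adjoint V))"
    "j < dim_col (map_mat quat_of_complex (mat_adjoint V))"
  then have ij: "i < m" "j < n" using A by auto
  then show "quat_adjoint (map_mat quat_of_complex V) $$ (i, j) = map_mat quat_of_complex (mat_adjoint V) $$ (i, j)"
    using A V by (simp add: quat_adjoint_index[OF V'] mat_adjoint_index[OF V])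
qed (use V mat_adjoint_carrier[OF V] in \<open>auto simp: quat_adjoint_def\<close>)

lemma map_cpart_mult_left:
  assumes A: "A \<in> carrier_mat n m" and M: "M \<in> carrier_mat m k"
  shows "map_mat cpart (map_mat quat_of_complex A * M) = A * map_mat cpart M"
proof (rule eq_matI)
  have c: "map_mat quat_of_complex A \<in> carrier_mat n m" "map_mat cpart M \<in> carrier_mat m k"
    using A M by simp_all
  fix i j assume "i < dim_row (A * map_mat cpart M)" "j < dim_col (A * map_mat cpart M)"
  then have ij: "i < n" "j < k" using A M by auto
  have "cpart ((map_mat quat_of_complex A * M) $$ (i, j)) = (A * map_mat cpart M) $$ (i, j)"
    using ij A M by (simp add: index_mat_mult[OF c(1) M ij] index_mat_mult[OF A c(2) ij] cpart_sum)
  then show "map_mat cpart (map_mat quat_of_complex A * M) $$ (i, j) = (A * map_mat cpart M) $$ (i, j)"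
    using ij A M by simp
qed (use A M in auto)

lemma map_cpart_mult_right:
  assumes M: "M \<in> carrier_mat n m" and B: "B \<in> carrier_mat m k"
  shows "map_mat cpart (M * map_mat quat_of_complex B) = map_mat cpart M * B"
proof (rule eq_matI)
  have c: "map_mat quat_of_complex B \<in> carrier_mat m k" "map_mat cpart M \<in> carrier_mat n m"
    using B M by simp_all
  fix i j assume "i < dim_row (map_mat cpart M * B)" "j < dim_col (map_mat cpart M * B)"
  then have ij: "i < n" "j < k" using B M by auto
  have "cpart ((M * map_mat quat_of_complex B) $$ (i, j)) = (map_mat cpart M * B) $$ (i, j)"
    using ij B M by (simp add: index_mat_mult[OF M c(1) ij] index_mat_mult[OF c(2) B ij] cpart_sum)
  then show "map_mat cpart (M * map_mat quat_of_complex B) $$ (i, j) = (map_mat cpart M * B) $$ (i, j)"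
    using ij B M by simp
qed (use B M in auto)

lemma quat_adjoint_four_block_diag:
  assumes "A \<in> carrier_mat p p" "B \<in> carrier_mat q q"
  shows "quat_adjoint (four_block_mat A (0\<^sub>m p q) (0\<^sub>m q p) B) =
    four_block_mat (quat_adjoint A) (0\<^sub>m p q) (0\<^sub>m q p) (quat_adjoint B)"
  by (rule eq_matI) (use assms in \<open>auto simp: quat_adjoint_def\<close>)

lemma mult_four_block_diag:
  fixes A A' B B' :: "'a :: semiring_0 mat"
  assumes c: "A \<in> carrier_mat p p" "A' \<in> carrier_mat p p" "B \<in> carrier_mat q q" "B' \<in> carrier_mat q q"
  shows "four_block_mat A (0\<^sub>m p q) (0\<^sub>m q p) B * four_block_mat A' (0\<^sub>m p q) (0\<^sub>m q p) B' =
    four_block_mat (A * A') (0\<^sub>m p q) (0\<^sub>m q p) (B * B')"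
proof -
  note prods = mult_carrier_mat[OF c(1,2)] mult_carrier_mat[OF c(3,4)]
  show ?thesis
    unfolding mult_four_block_mat[OF c(1) zero_carrier_mat zero_carrier_mat c(3)
        c(2) zero_carrier_mat zero_carrier_mat c(4)]
    using c prods by (intro cong_four_block_mat) simp_all
qed

lemma four_block_diag_unitary:
  assumes "A \<in> quat_unitary p" "B \<in> quat_unitary q"
  shows "four_block_mat A (0\<^sub>m p q) (0\<^sub>m q p) B \<in> quat_unitary (p + q)"
  using assms by (simp add: quat_unitary_def quat_adjoint_four_block_diag
      mult_four_block_diag[OF quat_adjoint_carrier _ quat_adjoint_carrier])

text \<open>In \<open>quat_adjoint U * U\<close> the unitary left factor cancels and the
  self-adjoint middle factor is squared; taking the complex part commutes with multiplication by the
  complex matrices on either side.\<close>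

lemma cpart_gram_of_decomposition:
  assumes eta: "\<eta> \<in> {quat_j, quat_k}" and qp: "q \<le> p"
    and K: "K \<in> quat_unitary (p + q)" and V: "V \<in> carrier_mat (p + q) (p + q)"
    and U: "U = K * hyperbolic_mat p q \<eta> \<theta> * map_mat quat_of_complex V"
  shows "map_mat cpart (quat_adjoint U * U) =
    mat_adjoint V * mat_diag (p + q) (\<lambda>i. of_real (hyperbolic_diag p q (\<lambda>i. 2 * \<theta> i) i)) * V"
proof -
  let ?n = "p + q"
  let ?H = "hyperbolic_mat p q \<eta> \<theta>" and ?V = "map_mat quat_of_complex V"
  have c: "K \<in> carrier_mat ?n ?n" "?H \<in> carrier_mat ?n ?n" "?V \<in> carrier_mat ?n ?n"
    "quat_adjoint K \<in> carrier_mat ?n ?n" "quat_adjoint ?V \<in> carrier_mat ?n ?n"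
    using K V hyperbolic_mat_carrier[OF qp] by (auto simp: quat_unitary_def)
  have KK: "quat_adjoint K * K = 1\<^sub>m ?n" using K by (simp add: quat_unitary_def)
  note a = assoc_mult_mat[where ?n\<^sub>1 = ?n and ?n\<^sub>2 = ?n and ?n\<^sub>3 = ?n and ?n\<^sub>4 = ?n]
  note m = mult_carrier_mat[where nr = ?n and n = ?n and nc = ?n]
  have "quat_adjoint U = quat_adjoint ?V * (?H * quat_adjoint K)"
    using c unfolding U
    by (simp only: quat_adjoint_mult[where n = ?n and m = ?n and k = ?n] m hyperbolic_mat_adjoint[OF eta qp])
  then have "quat_adjoint U * U = quat_adjoint ?V * (?H * (quat_adjoint K * (K * (?H * ?V))))"
    using c unfolding U by (simp only: a m)
  also have "quat_adjoint K * (K * (?H * ?V)) = (quat_adjoint K * K) * (?H * ?V)"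
    using c by (simp only: a m)
  also have "\<dots> = ?H * ?V"
    unfolding KK by (rule left_mult_one_mat[OF mult_carrier_mat[OF c(2,3)]])
  also have "quat_adjoint ?V * (?H * (?H * ?V)) = map_mat quat_of_complex (mat_adjoint V) * ((?H * ?H) * ?V)"
    using c by (simp only: a m quat_adjoint_map_quat_of_complex[OF V])
  finally have "map_mat cpart (quat_adjoint U * U) = mat_adjoint V * (map_mat cpart (?H * ?H) * V)"
    using map_cpart_mult_left[OF mat_adjoint_carrier[OF V] mult_carrier_mat[OF mult_carrier_mat[OF c(2,2)] c(3)]]
      map_cpart_mult_right[OF mult_carrier_mat[OF c(2,2)] V] by (simp only:)
  then show ?thesis
    unfolding cpart_hyperbolic_square[OF eta qp] using V mat_adjoint_carrier[OF V]
    by (simp only: a mat_diag_dim)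
qed

section \<open>Characteristic roots and the angles\<close>

lemma char_poly_mat_diag:
  "char_poly (mat_diag n f) = (\<Prod>a\<leftarrow>map f [0..<n]. [:- a, 1:])"
proof -
  have "diag_mat (mat_diag n f) = map f [0..<n]"
    by (auto simp: diag_mat_def mat_diag_def)
  moreover have "upper_triangular (mat_diag n f)" by (auto simp: mat_diag_def upper_triangular_def)
  ultimately show ?thesis by (simp add: char_poly_upper_triangular[OF mat_diag_dim])
qed

lemma proots_prod_list_linear: "proots (\<Prod>a\<leftarrow>xs. [:- a, 1:]) = mset xs"
  for xs :: "'a :: {idom, idom_divide} list"
proof (induction xs)
  case (Cons a xs)
  have "(\<Prod>a\<leftarrow>xs. [:- a, 1:]) \<noteq> 0" by (auto simp: prod_list_zero_iff)
  then have "proots ([:- a, 1:] * (\<Prod>a\<leftarrow>xs. [:- a, 1:])) = proots [:- a, 1:] + mset xs"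
    using Cons.IH by (subst proots_mult) auto
  then show ?case by simp
qed simp

text \<open>The signature matrix times the complex part of \<open>quat_adjoint U * U\<close> depends
  on \<open>U\<close> alone, while every decomposition makes it similar to an explicit diagonal
  matrix. Comparing negative characteristic roots gives the multiset of the
  \<open>cosh (2 * \<theta> i)\<close>, hence the absolute values of the angles up to order.\<close>

lemma hyperbolic_angles_unique:
  assumes eta: "\<eta> \<in> {quat_j, quat_k}" and qp: "q \<le> p"
    and K: "K \<in> quat_unitary (p + q)" and V: "V \<in> complex_indefinite_unitary p q"
    and U: "U = K * hyperbolic_mat p q \<eta> \<theta> * map_mat quat_of_complex V"
    and K': "K' \<in> quat_unitary (p + q)" and V': "V' \<in> complex_indefinite_unitary p q"
    and U': "U = K' * hyperbolic_mat p q \<eta> \<theta>' * map_mat quat_of_complex V'"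
  shows "\<exists>\<pi>. \<pi> permutes {..<q} \<and> (\<forall>i<q. \<bar>\<theta>' i\<bar> = \<bar>\<theta> (\<pi> i)\<bar>)"
proof -
  let ?n = "p + q" and ?J = "signature_mat p q :: complex mat"
  define f where "f \<theta> i = (of_real (signature_sign p i * hyperbolic_diag p q (\<lambda>i. 2 * \<theta> i) i) :: complex)" for \<theta> i
  have poly: "char_poly (?J * map_mat cpart (quat_adjoint U * U)) = char_poly (mat_diag ?n (f \<theta>))"
    if K: "K \<in> quat_unitary ?n" and V: "V \<in> complex_indefinite_unitary p q"
      and U: "U = K * hyperbolic_mat p q \<eta> \<theta> * map_mat quat_of_complex V" for K V \<theta>
  proof (rule char_poly_similar)
    let ?D = "mat_diag ?n (\<lambda>i. of_real (hyperbolic_diag p q (\<lambda>i. 2 * \<theta> i) i)) :: complex mat"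
    let ?A = "mat_adjoint V"
    have cV: "V \<in> carrier_mat ?n ?n" and VJ: "?A * ?J * V = ?J"
      using V by (auto simp: complex_indefinite_unitary_def)
    have cD: "?D \<in> carrier_mat ?n ?n" "mat_diag ?n (f \<theta>) \<in> carrier_mat ?n ?n" by simp_all
    note c = cV mat_adjoint_carrier[OF cV] signature_mat_carrier[of p q, where 'a = complex] cD
    note a = assoc_mult_mat[where ?n\<^sub>1 = ?n and ?n\<^sub>2 = ?n and ?n\<^sub>3 = ?n and ?n\<^sub>4 = ?n]
    note m = mult_carrier_mat[where nr = ?n and n = ?n and nc = ?n]
    have inv: "(?J * ?A * ?J) * V = 1\<^sub>m ?n" "V * (?J * ?A * ?J) = 1\<^sub>m ?n"
      by (rule pseudo_unitary_swap(2,3)[OF c(2,1,3) signature_mat_square VJ],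
          erule (2) mat_mult_left_right_inverse)+
    have JD: "?J * ?D = mat_diag ?n (f \<theta>)"
      unfolding signature_mat_eq_mat_diag mat_diag_diag by (simp add: f_def[abs_def])
    have "?J * map_mat cpart (quat_adjoint U * U) = ?J * ?A * (?D * V)"
      unfolding cpart_gram_of_decomposition[OF eta qp K cV U] using c by (simp only: a m)
    \<comment> \<open>Inserting \<open>?J * ?J\<close> in front of \<open>?D\<close> exposes
      \<open>?J * ?A * ?J\<close>, the inverse of \<open>V\<close>.\<close>
    also have "?D = (?J * ?J) * ?D" unfolding signature_mat_square by (rule left_mult_one_mat[OF c(4), symmetric])
    also have "?J * ?A * ((?J * ?J) * ?D * V) = (?J * ?A * ?J) * (?J * ?D) * V"
      using c by (simp only: a m)
    finally have eq: "?J * map_mat cpart (quat_adjoint U * U) = (?J * ?A * ?J) * mat_diag ?n (f \<theta>) * V"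
      unfolding JD .
    have cA: "?J * ?A * ?J \<in> carrier_mat ?n ?n" by (intro m c)
    then have "?J * map_mat cpart (quat_adjoint U * U) \<in> carrier_mat ?n ?n"
      unfolding eq by (intro m c)
    with cA c show "similar_mat (?J * map_mat cpart (quat_adjoint U * U)) (mat_diag ?n (f \<theta>))"
      by (intro similar_matI[OF _ inv eq]) blast
  qed
  have mset: "proots (char_poly (mat_diag ?n (f \<theta>))) = image_mset (f \<theta>) (mset_set {..<?n})" for \<theta>
    unfolding char_poly_mat_diag proots_prod_list_linear by (simp add: lessThan_atLeast0)
  have eq: "image_mset (f \<theta>) (mset_set {..<?n}) = image_mset (f \<theta>') (mset_set {..<?n})"
    using poly[OF K V U] poly[OF K' V' U'] mset by metis
  \<comment> \<open>All entries of \<open>hyperbolic_diag\<close> are positive, so the negative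
    roots are those of the last \<open>q\<close> rows.\<close>
  have neg: "filter_mset (\<lambda>z. Re z < 0) (image_mset (f \<theta>) (mset_set {..<?n})) =
      image_mset (\<lambda>i. of_real (- cosh (2 * \<theta> i))) (mset_set {..<q})" for \<theta>
  proof -
    have "{i \<in> {..<?n}. Re (f \<theta> i) < 0} = (+) p ` {..<q}"
    proof -
      have "Re (f \<theta> i) < 0 \<longleftrightarrow> p \<le> i" if "i < ?n" for i
        using that qp cosh_real_pos[of "2 * \<theta> i"] cosh_real_pos[of "2 * \<theta> (i - p)"]
        by (auto simp: f_def signature_sign_def hyperbolic_diag_def not_less)
      then have "{i \<in> {..<?n}. Re (f \<theta> i) < 0} = {p..<p + q}" by auto
      also have "\<dots> = (+) p ` {..<q}"
        by (simp add: lessThan_atLeast0 image_add_atLeastLessThan add.commute)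
      finally show ?thesis .
    qed
    then have "filter_mset (\<lambda>z. Re z < 0) (image_mset (f \<theta>) (mset_set {..<?n})) =
        image_mset (f \<theta>) (image_mset ((+) p) (mset_set {..<q}))"
      by (simp add: filter_mset_image_mset image_mset_mset_set)
    also have "\<dots> = image_mset (\<lambda>i. of_real (- cosh (2 * \<theta> i))) (mset_set {..<q})"
      unfolding image_mset.compositionality
      by (intro image_mset_cong) (use qp in \<open>auto simp: f_def signature_sign_def hyperbolic_diag_def\<close>)
    finally show ?thesis .
  qed
  have "image_mset (\<lambda>i. of_real (- cosh (2 * \<theta>' i)) :: complex) (mset_set {..<q}) =
      image_mset (\<lambda>i. of_real (- cosh (2 * \<theta> i))) (mset_set {..<q})"
    using arg_cong[OF eq, of "filter_mset (\<lambda>z. Re z < 0)"] unfolding neg by simp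
  then obtain \<pi> where "\<pi> permutes {..<q}"
    and "\<forall>i\<in>{..<q}. (of_real (- cosh (2 * \<theta>' i)) :: complex) = of_real (- cosh (2 * \<theta> (\<pi> i)))"
    by (rule image_mset_eq_implies_permutes[OF finite_lessThan])
  \<comment> \<open>\<open>cosh\<close> agrees at two real numbers exactly if their absolute values
    agree.\<close>
  then show ?thesis
    by (intro exI[of _ \<pi>]) (auto simp: abs_mult simp del: of_real_minus)
qed

section \<open>Existence of the decomposition\<close>

definition quat_row :: "quat \<Rightarrow> nat \<Rightarrow> (nat \<Rightarrow> complex) \<Rightarrow> nat \<Rightarrow> quat" where
  "quat_row \<eta> q x j = quat_of_complex (x j) + quat_of_complex (x (q + j)) * \<eta>"

text \<open>The \<open>2q\<close> complex vectors \<open>\<alpha> e\<^sub>j\<close> and \<open>\<alpha> (\<eta> e\<^sub>j)\<close>: the map \<open>\<alpha>\<close> is \<open>lin_comb (q + q) (row_parts \<eta> q W)\<close>.\<close>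

definition row_parts :: "quat \<Rightarrow> nat \<Rightarrow> (nat \<Rightarrow> nat \<Rightarrow> quat) \<Rightarrow> nat \<Rightarrow> nat \<Rightarrow> complex" where
  "row_parts \<eta> q W j t = (if j < q then cpart (W j t) else cpart (\<eta> * W (j - q) t))"

context
  fixes \<eta> :: quat
  assumes eta: "\<eta> \<in> {quat_j, quat_k}"
begin

lemma eta_mult_quat_row: "j < q \<Longrightarrow> \<eta> * quat_row \<eta> q x j = quat_row \<eta> q (quat_flip q x) j"
proof -
  have comm: "\<eta> * quat_of_complex a = quat_of_complex (cnj a) * \<eta>" for a
    using eta_simps(4)[OF eta, of "cnj a"] by simp
  have "\<eta> * (quat_of_complex b * \<eta>) = - quat_of_complex (cnj b)" for b
    by (simp only: mult.assoc[symmetric] comm) (simp add: mult.assoc eta_simps(1)[OF eta])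
  then show "j < q \<Longrightarrow> ?thesis"
    by (simp add: quat_row_def quat_flip_def distrib_left comm quat_of_complex_simps add.commute)
qed

lemma cpart_row_combination:
  "cpart (\<Sum>j<q. quat_row \<eta> q x j * W j t) = lin_comb (q + q) (row_parts \<eta> q W) x t"
  by (simp add: cpart_sum lin_comb_def sum_lessThan_add row_parts_def quat_row_def distrib_right
      mult.assoc sum.distrib)

lemma cpart_eta_row_combination:
  "cpart (\<eta> * (\<Sum>j<q. quat_row \<eta> q x j * W j t)) =
    lin_comb (q + q) (row_parts \<eta> q W) (quat_flip q x) t"
proof -
  have "\<eta> * (\<Sum>j<q. quat_row \<eta> q x j * W j t) = (\<Sum>j<q. quat_row \<eta> q (quat_flip q x) j * W j t)"
    by (simp add: sum_distrib_left mult.assoc[symmetric] eta_mult_quat_row)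
  then show ?thesis by (simp add: cpart_row_combination)
qed

text \<open>This has the shape of a bottom row of the hyperbolic factor times a complex matrix,
  where \<open>cosh\<close> and \<open>- sinh\<close> times \<eta> are the coefficients, so the two
  can be matched.\<close>

lemma row_combination_decomp:
  "(\<Sum>j<q. quat_row \<eta> q x j * W j t) =
    quat_of_complex (lin_comb (q + q) (row_parts \<eta> q W) x t)
    - \<eta> * quat_of_complex (lin_comb (q + q) (row_parts \<eta> q W) (quat_flip q x) t)"
  using quat_eta_decomp[OF eta, of "\<Sum>j<q. quat_row \<eta> q x j * W j t"]
  by (simp only: cpart_row_combination cpart_eta_row_combination)

lemma cpart_quat_row: "cpart (quat_row \<eta> q x j) = x j"
  by (simp add: quat_row_def eta_simps(3)[OF eta])

text \<open>A quaternion is determined by its complex part and that of its \<eta>-multiple, so both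
  equations together compute the quaternionic inner product of rows. They turn the orthogonality
  relations of the spectral theorem into unitarity.\<close>

lemma cpart_quat_row_inner:
  "cpart (\<Sum>j<q. quat_row \<eta> q x j * qcnj (quat_row \<eta> q y j)) = cinner (q + q) x y"
  "cpart (\<eta> * (\<Sum>j<q. quat_row \<eta> q x j * qcnj (quat_row \<eta> q y j))) = cinner (q + q) (quat_flip q x) y"
proof -
  have 1: "cpart (\<Sum>j<q. quat_row \<eta> q x j * qcnj (quat_row \<eta> q y j)) = cinner (q + q) x y" for x y
    by (simp add: cpart_sum hform_def sum_lessThan_add cpart_mult_qcnj[OF eta] eta_mult_quat_row
        cpart_quat_row quat_flip_def sum.distrib add.commute)
  show "cpart (\<Sum>j<q. quat_row \<eta> q x j * qcnj (quat_row \<eta> q y j)) = cinner (q + q) x y" by (rule 1)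
  have "\<eta> * (\<Sum>j<q. quat_row \<eta> q x j * qcnj (quat_row \<eta> q y j)) =
      (\<Sum>j<q. quat_row \<eta> q (quat_flip q x) j * qcnj (quat_row \<eta> q y j))"
    by (simp add: sum_distrib_left mult.assoc[symmetric] eta_mult_quat_row)
  then show "cpart (\<eta> * (\<Sum>j<q. quat_row \<eta> q x j * qcnj (quat_row \<eta> q y j))) = cinner (q + q) (quat_flip q x) y"
    by (simp add: 1)
qed

text \<open>The rows have Gram matrix \<open>- I\<close>, so the quaternionic form of two
  combinations is minus the inner product of their coefficients. Its complex part, split by
  \<open>cpart_mult_qcnj\<close>, is the relation \<open>E\<close> of the spectral theorem.\<close>

lemma hform_row_parts:
  fixes W :: "nat \<Rightarrow> nat \<Rightarrow> quat" and e :: "nat \<Rightarrow> real"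
  assumes W: "\<And>j l. j < q \<Longrightarrow> l < q \<Longrightarrow>
    (\<Sum>t<n. W j t * of_real (e t) * qcnj (W l t)) = (if j = l then - 1 else 0)"
  defines "R \<equiv> row_parts \<eta> q W"
  shows "hform e n (lin_comb (q + q) R x) (lin_comb (q + q) R y)
      + cnj (hform e n (lin_comb (q + q) R (quat_flip q x)) (lin_comb (q + q) R (quat_flip q y)))
      = - cinner (q + q) x y"
proof -
  let ?r = "quat_row \<eta> q"
  let ?Z = "\<lambda>x t. \<Sum>j<q. ?r x j * W j t"
  have "(\<Sum>t<n. ?Z x t * (of_real (e t) * qcnj (?Z y t))) =
      (\<Sum>t<n. \<Sum>j<q. \<Sum>l<q. ?r x j * (W j t * of_real (e t) * qcnj (W l t)) * qcnj (?r y l))"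
  proof (rule sum.cong[OF refl])
    fix t
    have "of_real (e t) * qcnj (?Z y t) = (\<Sum>l<q. of_real (e t) * qcnj (W l t) * qcnj (?r y l))"
      by (simp add: qcnj_sum qcnj_mult sum_distrib_left mult.assoc)
    then show "?Z x t * (of_real (e t) * qcnj (?Z y t)) =
        (\<Sum>j<q. \<Sum>l<q. ?r x j * (W j t * of_real (e t) * qcnj (W l t)) * qcnj (?r y l))"
      by (simp only: sum_product) (simp add: mult.assoc)
  qed
  also have "\<dots> = (\<Sum>j<q. \<Sum>t<n. \<Sum>l<q. ?r x j * (W j t * of_real (e t) * qcnj (W l t)) * qcnj (?r y l))"
    by (rule sum.swap)
  also have "\<dots> = (\<Sum>j<q. \<Sum>l<q. \<Sum>t<n. ?r x j * (W j t * of_real (e t) * qcnj (W l t)) * qcnj (?r y l))"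
    by (intro sum.cong refl sum.swap)
  also have "\<dots> = (\<Sum>j<q. \<Sum>l<q. ?r x j * (\<Sum>t<n. W j t * of_real (e t) * qcnj (W l t)) * qcnj (?r y l))"
    by (simp only: sum_distrib_left sum_distrib_right)
  also have "\<dots> = (\<Sum>j<q. \<Sum>l<q. if j = l then - (?r x j * qcnj (?r y j)) else 0)"
    by (intro sum.cong refl) (simp add: W)
  also have "\<dots> = - (\<Sum>j<q. ?r x j * qcnj (?r y j))"
    by (simp add: sum_negf)
  finally have "cpart (\<Sum>t<n. ?Z x t * (of_real (e t) * qcnj (?Z y t))) = - cinner (q + q) x y"
    by (simp only: cpart_quat_row_inner cpart_simps)
  moreover have "cpart (\<Sum>t<n. ?Z x t * (of_real (e t) * qcnj (?Z y t))) =
      (\<Sum>t<n. cpart (of_real (e t) * (?Z x t * qcnj (?Z y t))))"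
    unfolding cpart_sum
    by (simp only: mult_of_real_left_commute)
  moreover have "\<dots> = hform e n (lin_comb (q + q) R x) (lin_comb (q + q) R y)
      + cnj (hform e n (lin_comb (q + q) R (quat_flip q x)) (lin_comb (q + q) R (quat_flip q y)))"
    by (simp only: cpart_simps(10) cpart_mult_qcnj[OF eta] cpart_row_combination
        cpart_eta_row_combination R_def[symmetric])
       (simp add: hform_def sum.distrib algebra_simps)
  ultimately show ?thesis by simp
qed

end

section \<open>Gram matrices and the indefinite unitary groups\<close>

lemma quat_gram_index:
  assumes A: "A \<in> carrier_mat (p + q) (p + q)" and ij: "i < p + q" "j < p + q"
  shows "(A * signature_mat p q * quat_adjoint A) $$ (i, j) =
    (\<Sum>t<p + q. A $$ (i, t) * of_real (signature_sign p t) * qcnj (A $$ (j, t)))"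
proof -
  have "A * signature_mat p q \<in> carrier_mat (p + q) (p + q)"
    by (intro mult_carrier_mat[OF A] signature_mat_carrier)
  from index_mat_mult[OF this quat_adjoint_carrier[OF A] ij] show ?thesis
    unfolding signature_mat_eq_mat_diag mat_diag_mult_right[OF A]
    using ij by (auto simp: quat_adjoint_index[OF A] intro!: sum.cong)
qed

lemma complex_gram_index:
  assumes A: "A \<in> carrier_mat (p + q) (p + q)" and ij: "i < p + q" "j < p + q"
  shows "(A * signature_mat p q * mat_adjoint A) $$ (i, j) =
    hform (signature_sign p) (p + q) (\<lambda>t. A $$ (i, t)) (\<lambda>t. A $$ (j, t))"
proof -
  have "A * signature_mat p q \<in> carrier_mat (p + q) (p + q)"
    by (intro mult_carrier_mat[OF A] signature_mat_carrier)
  from index_mat_mult[OF this mat_adjoint_carrier[OF A] ij] show ?thesis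
    unfolding signature_mat_eq_mat_diag mat_diag_mult_right[OF A] hform_def
    using ij by (auto simp: mat_adjoint_index[OF A] intro!: sum.cong)
qed

lemma signature_mat_index:
  "i < p + q \<Longrightarrow> j < p + q \<Longrightarrow> signature_mat p q $$ (i, j) =
    (if i = j then of_real (signature_sign p i) else 0 :: 'a :: real_algebra_1)"
  by (auto simp: signature_mat_eq_mat_diag mat_diag_def)

lemma signature_mat_dim [simp]:
  "dim_row (signature_mat p q) = p + q" "dim_col (signature_mat p q) = p + q"
  by (simp_all add: signature_mat_def)

lemma quat_indefinite_unitaryD:
  assumes "A \<in> quat_indefinite_unitary p q"
  shows "A \<in> carrier_mat (p + q) (p + q)" "quat_adjoint A * signature_mat p q * A = signature_mat p q"
    "A * signature_mat p q * quat_adjoint A = signature_mat p q"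
    "signature_mat p q * quat_adjoint A * signature_mat p q * A = 1\<^sub>m (p + q)"
    "A * (signature_mat p q * quat_adjoint A * signature_mat p q) = 1\<^sub>m (p + q)"
proof -
  show 1: "A \<in> carrier_mat (p + q) (p + q)" and 2: "quat_adjoint A * signature_mat p q * A = signature_mat p q"
    using assms by (auto simp: quat_indefinite_unitary_def)
  show "A * signature_mat p q * quat_adjoint A = signature_mat p q"
    "signature_mat p q * quat_adjoint A * signature_mat p q * A = 1\<^sub>m (p + q)"
    "A * (signature_mat p q * quat_adjoint A * signature_mat p q) = 1\<^sub>m (p + q)"
    by (rule pseudo_unitary_swap[OF quat_adjoint_carrier[OF 1] 1 signature_mat_carrier signature_mat_square 2],
        erule (2) quat_mat_mult_left_right_inverse)+
qed

lemma quat_indefinite_unitary_mult: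
  assumes A: "A \<in> quat_indefinite_unitary p q" and B: "B \<in> quat_indefinite_unitary p q"
  shows "A * B \<in> quat_indefinite_unitary p q"
proof -
  let ?n = "p + q" and ?J = "signature_mat p q :: quat mat"
  note c = quat_indefinite_unitaryD(1)[OF A] quat_indefinite_unitaryD(1)[OF B]
    quat_adjoint_carrier[OF quat_indefinite_unitaryD(1)[OF A]]
    quat_adjoint_carrier[OF quat_indefinite_unitaryD(1)[OF B]]
    signature_mat_carrier[of p q, where 'a = quat]
  note a = assoc_mult_mat[where ?n\<^sub>1 = ?n and ?n\<^sub>2 = ?n and ?n\<^sub>3 = ?n and ?n\<^sub>4 = ?n]
  note m = mult_carrier_mat[where nr = ?n and n = ?n and nc = ?n]
  have "quat_adjoint (A * B) * ?J * (A * B) = quat_adjoint B * (quat_adjoint A * ?J * A) * B"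
    using c by (simp only: quat_adjoint_mult[OF c(1,2)] a m)
  then show ?thesis
    using quat_indefinite_unitaryD(2)[OF A] quat_indefinite_unitaryD(2)[OF B] m[OF c(1,2)]
    by (simp add: quat_indefinite_unitary_def)
qed

lemma quat_adjoint_signature_mat [simp]: "quat_adjoint (signature_mat p q) = signature_mat p q"
  by (rule eq_matI)
     (auto simp: quat_adjoint_index[OF signature_mat_carrier] signature_mat_index, auto simp: quat_adjoint_def)

lemma quat_indefinite_unitary_inverse:
  assumes A: "A \<in> quat_indefinite_unitary p q"
  shows "signature_mat p q * quat_adjoint A * signature_mat p q \<in> quat_indefinite_unitary p q"
proof -
  let ?n = "p + q" and ?J = "signature_mat p q :: quat mat"
  note c = quat_indefinite_unitaryD(1)[OF A] quat_adjoint_carrier[OF quat_indefinite_unitaryD(1)[OF A]]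
    signature_mat_carrier[of p q, where 'a = quat]
  note a = assoc_mult_mat[where ?n\<^sub>1 = ?n and ?n\<^sub>2 = ?n and ?n\<^sub>3 = ?n and ?n\<^sub>4 = ?n]
  note m = mult_carrier_mat[where nr = ?n and n = ?n and nc = ?n]
  let ?B = "?J * quat_adjoint A * ?J"
  have cB: "?B \<in> carrier_mat ?n ?n" by (intro m c)
  have "quat_adjoint ?B = ?J * (A * ?J)"
    using c by (simp add: quat_adjoint_mult[where n = ?n and m = ?n and k = ?n] m)
  then have "quat_adjoint ?B * ?J * ?B = ?J * A * ((?J * ?J) * ?J) * (quat_adjoint A * ?J)"
    using c by (simp only: a m)
  also have "(?J * ?J) * ?J = ?J"
    unfolding signature_mat_square by (rule left_mult_one_mat[OF c(3)])
  also have "?J * A * ?J * (quat_adjoint A * ?J) = ?J * (A * ?J * quat_adjoint A) * ?J"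
    using c by (simp only: a m)
  also have "\<dots> = (?J * ?J) * ?J" unfolding quat_indefinite_unitaryD(3)[OF A] by (rule refl)
  also have "\<dots> = ?J"
    unfolding signature_mat_square by (rule left_mult_one_mat[OF c(3)])
  finally show ?thesis using cB by (simp add: quat_indefinite_unitary_def)
qed

lemma map_quat_of_complex_mult:
  assumes A: "A \<in> carrier_mat n m" and B: "B \<in> carrier_mat m k"
  shows "map_mat quat_of_complex (A * B) = map_mat quat_of_complex A * map_mat quat_of_complex B"
proof (rule eq_matI)
  have c: "map_mat quat_of_complex A \<in> carrier_mat n m" "map_mat quat_of_complex B \<in> carrier_mat m k"
    using A B by simp_all
  fix i j assume "i < dim_row (map_mat quat_of_complex A * map_mat quat_of_complex B)"
    "j < dim_col (map_mat quat_of_complex A * map_mat quat_of_complex B)"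
  then have ij: "i < n" "j < k" using A B by auto
  have "quat_of_complex ((A * B) $$ (i, j)) = (map_mat quat_of_complex A * map_mat quat_of_complex B) $$ (i, j)"
    using ij A B by (simp add: index_mat_mult[OF A B ij] index_mat_mult[OF c ij] quat_of_complex_sum quat_of_complex_simps)
  then show "map_mat quat_of_complex (A * B) $$ (i, j) =
      (map_mat quat_of_complex A * map_mat quat_of_complex B) $$ (i, j)"
    using ij A B by simp
qed (use A B in auto)

lemma map_quat_of_complex_indefinite_unitary:
  assumes V: "V \<in> complex_indefinite_unitary p q"
  shows "map_mat quat_of_complex V \<in> quat_indefinite_unitary p q"
proof -
  have c: "V \<in> carrier_mat (p + q) (p + q)" and VJ: "mat_adjoint V * signature_mat p q * V = signature_mat p q"
    using V by (auto simp: complex_indefinite_unitary_def)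
  have J: "map_mat quat_of_complex (signature_mat p q) = signature_mat p q"
    by (rule eq_matI) (auto simp: signature_mat_index quat_of_complex_simps)
  note cJ = mult_carrier_mat[OF mat_adjoint_carrier[OF c] signature_mat_carrier]
  have "map_mat quat_of_complex (mat_adjoint V * signature_mat p q * V) =
      map_mat quat_of_complex (mat_adjoint V) * map_mat quat_of_complex (signature_mat p q) * map_mat quat_of_complex V"
    by (simp only: map_quat_of_complex_mult[OF cJ c]
        map_quat_of_complex_mult[OF mat_adjoint_carrier[OF c] signature_mat_carrier])
  then show ?thesis
    using c by (simp add: VJ J quat_indefinite_unitary_def quat_adjoint_map_quat_of_complex[OF c])
qed

lemma four_block_diag_indefinite_unitary:
  assumes A: "A \<in> quat_unitary p" and B: "B \<in> quat_unitary q"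
  shows "four_block_mat A (0\<^sub>m p q) (0\<^sub>m q p) B \<in> quat_indefinite_unitary p q"
proof -
  have c: "A \<in> carrier_mat p p" "B \<in> carrier_mat q q" and AB: "quat_adjoint A * A = 1\<^sub>m p" "quat_adjoint B * B = 1\<^sub>m q"
    using A B by (auto simp: quat_unitary_def)
  note ca = quat_adjoint_carrier[OF c(1)] quat_adjoint_carrier[OF c(2)]
  have dims: "dim_col (quat_adjoint B) = dim_row (1\<^sub>m q :: quat mat)" "dim_col (quat_adjoint B) = dim_row B"
    using c by (auto simp: quat_adjoint_def)
  have neg: "quat_adjoint B * - 1\<^sub>m q = - quat_adjoint B" "- quat_adjoint B * B = - (quat_adjoint B * B)"
    unfolding uminus_mult_right_mat[OF dims(1)] uminus_mult_left_mat[OF dims(2)] right_mult_one_mat[OF ca(2)]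
    by (rule refl)+
  have cm: "- 1\<^sub>m q \<in> carrier_mat q q" "- quat_adjoint B \<in> carrier_mat q q" using ca by auto
  have "quat_adjoint (four_block_mat A (0\<^sub>m p q) (0\<^sub>m q p) B) * signature_mat p q * four_block_mat A (0\<^sub>m p q) (0\<^sub>m q p) B
      = signature_mat p q"
    unfolding signature_mat_def quat_adjoint_four_block_diag[OF c]
      mult_four_block_diag[OF ca(1) one_carrier_mat ca(2) cm(1)] neg(1) right_mult_one_mat[OF ca(1)]
      mult_four_block_diag[OF ca(1) c(1) cm(2) c(2)] neg(2) AB ..
  then show ?thesis using c by (simp add: quat_indefinite_unitary_def)
qed

text \<open>The Gram relation between a row \<open>i < p\<close> and a bottom unit row forces the
  upper right entries to vanish; the relations among the first \<open>p\<close> rows then make the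
  upper left block unitary.\<close>

lemma quat_indefinite_unitary_block_diag:
  assumes G: "G \<in> quat_indefinite_unitary p q"
    and bottom: "\<And>i t. i < q \<Longrightarrow> t < p + q \<Longrightarrow> G $$ (p + i, t) = (if t = p + i then 1 else 0)"
  shows "\<exists>A \<in> quat_unitary p. G = four_block_mat A (0\<^sub>m p q) (0\<^sub>m q p) (1\<^sub>m q)"
proof -
  note cG = quat_indefinite_unitaryD(1)[OF G]
  have gram: "(\<Sum>t<p + q. G $$ (i, t) * of_real (signature_sign p t) * qcnj (G $$ (j, t))) =
      (if i = j then of_real (signature_sign p i) else 0)" if "i < p + q" "j < p + q" for i j
    using quat_gram_index[OF cG that] quat_indefinite_unitaryD(3)[OF G] signature_mat_index[OF that, where 'a = quat]
    by simp
  have zero: "G $$ (i, p + b) = 0" if "i < p" "b < q" for i b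
  proof -
    have "(\<Sum>t<p + q. G $$ (i, t) * of_real (signature_sign p t) * qcnj (G $$ (p + b, t))) =
        (\<Sum>t<p + q. if t = p + b then - G $$ (i, t) else 0)"
      using that by (intro sum.cong) (auto simp: bottom signature_sign_def)
    also have "\<dots> = - G $$ (i, p + b)" using that by simp
    finally show ?thesis using gram[of i "p + b"] that by simp
  qed
  define A where "A = mat p p (\<lambda>(i, j). G $$ (i, j))"
  have cA: "A \<in> carrier_mat p p" by (simp add: A_def)
  have "A * quat_adjoint A = 1\<^sub>m p"
  proof (rule eq_matI)
    fix i j assume "i < dim_row (1\<^sub>m p :: quat mat)" "j < dim_col (1\<^sub>m p :: quat mat)"
    then have ij: "i < p" "j < p" by auto
    have "(A * quat_adjoint A) $$ (i, j) = (\<Sum>t<p. G $$ (i, t) * qcnj (G $$ (j, t)))"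
      unfolding index_mat_mult[OF cA quat_adjoint_carrier[OF cA] ij]
      using ij by (intro sum.cong) (auto simp: quat_adjoint_index[OF cA], auto simp: A_def)
    also have "\<dots> = (\<Sum>t<p + q. G $$ (i, t) * of_real (signature_sign p t) * qcnj (G $$ (j, t)))"
      using ij by (simp add: sum_lessThan_add zero signature_sign_def)
    also have "\<dots> = 1\<^sub>m p $$ (i, j)" using gram[of i j] ij by (simp add: signature_sign_def)
    finally show "(A * quat_adjoint A) $$ (i, j) = 1\<^sub>m p $$ (i, j)" .
  qed (use cA in \<open>auto simp: quat_adjoint_def\<close>)
  then have "A \<in> quat_unitary p"
    using quat_mat_mult_left_right_inverse[OF cA quat_adjoint_carrier[OF cA]] cA
    by (simp add: quat_unitary_def)
  moreover have "G = four_block_mat A (0\<^sub>m p q) (0\<^sub>m q p) (1\<^sub>m q)"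
  proof (rule eq_matI)
    fix i j assume "i < dim_row (four_block_mat A (0\<^sub>m p q) (0\<^sub>m q p) (1\<^sub>m q))"
      "j < dim_col (four_block_mat A (0\<^sub>m p q) (0\<^sub>m q p) (1\<^sub>m q))"
    then have ij: "i < p + q" "j < p + q" using cA by auto
    show "G $$ (i, j) = four_block_mat A (0\<^sub>m p q) (0\<^sub>m q p) (1\<^sub>m q) $$ (i, j)"
    proof (cases "i < p")
      case True
      have "j - p < q" if "\<not> j < p" using ij that by linarith
      with True show ?thesis using ij cA zero[of i "j - p"] by (auto simp: A_def)
    next
      case False
      then have i: "i - p < q" "p + (i - p) = i" using ij by linarith+
      from False show ?thesis using ij cA bottom[OF i(1) ij(2)] unfolding i(2) by auto
    qed
  qed (use cG cA in auto)
  ultimately show ?thesis by blast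
qed

section \<open>Construction of the factors\<close>

lemma quat_indefinite_unitary_decomposition:
  assumes eta: "\<eta> \<in> {quat_j, quat_k}" and qp: "q \<le> p" and U: "U \<in> quat_indefinite_unitary p q"
  shows "\<exists>\<theta>. \<exists>Up \<in> quat_unitary p. \<exists>Uq \<in> quat_unitary q. \<exists>V \<in> complex_indefinite_unitary p q.
    U = four_block_mat Up (0\<^sub>m p q) (0\<^sub>m q p) Uq * hyperbolic_mat p q \<eta> \<theta> * map_mat quat_of_complex V"
proof -
  let ?n = "p + q"
  let ?h = "hform (signature_sign p) ?n"
  note cU = quat_indefinite_unitaryD(1)[OF U]
  define W where "W j t = U $$ (p + j, t)" for j t
  have W_gram: "(\<Sum>t<?n. W j t * of_real (signature_sign p t) * qcnj (W l t)) = (if j = l then - 1 else 0)"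
    if "j < q" "l < q" for j l
  proof -
    have s: "signature_sign p (p + i) = - 1" for i by (simp add: signature_sign_def)
    show ?thesis
      using quat_gram_index[OF cU, of "p + j" "p + l"] that
      by (simp add: W_def quat_indefinite_unitaryD(3)[OF U] signature_mat_index s split: if_splits)
  qed
  define \<alpha> where "\<alpha> = lin_comb (q + q) (row_parts \<eta> q W)"
  have E: "?h (\<alpha> x) (\<alpha> y) + cnj (?h (\<alpha> (quat_flip q x)) (\<alpha> (quat_flip q y))) = - cinner (q + q) x y" for x y
    unfolding \<alpha>_def by (rule hform_row_parts[OF eta W_gram])
  obtain x g where
    x0: "\<forall>i<q. \<forall>j<q. cinner (q + q) (x i) (x j) = (if i = j then 1 else 0) \<and>
      cinner (q + q) (x i) (quat_flip q (x j)) = 0"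
    and g0: "\<forall>i<q. g i \<le> - 1 / 2 \<and> (\<forall>y. ?h (\<alpha> (x i)) (\<alpha> y) = of_real (g i) * cinner (q + q) (x i) y)"
    using quaternionic_spectral[OF E[unfolded \<alpha>_def] order.refl] unfolding \<alpha>_def[symmetric] by (elim exE conjE)
  have xx: "cinner (q + q) (x i) (x j) = (if i = j then 1 else 0)"
    and xs: "cinner (q + q) (x i) (quat_flip q (x j)) = 0" if "i < q" "j < q" for i j
    using x0 that by blast+
  have g_le: "g i \<le> - 1 / 2"
    and eig: "?h (\<alpha> (x i)) (\<alpha> y) = of_real (g i) * cinner (q + q) (x i) y" if "i < q" for i y
    using g0 that by blast+
  have eigs: "?h (\<alpha> (quat_flip q (x i))) (\<alpha> y) = of_real (- 1 - g i) * cinner (q + q) (quat_flip q (x i)) y"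
    if "i < q" for i y
    unfolding \<alpha>_def
    by (rule eigenform_flip[OF E[unfolded \<alpha>_def]]) (use eig[OF that] in \<open>simp add: \<alpha>_def\<close>)
  define v where "v i = \<alpha> (x i)" for i
  define w where "w i = \<alpha> (quat_flip q (x i))" for i
  have vv: "?h (v i) (v j) = (if i = j then of_real (g i) else 0)"
    and ww: "?h (w i) (w j) = (if i = j then of_real (- 1 - g i) else 0)"
    and vw: "?h (v i) (w j) = 0" if "i < q" "j < q" for i j
    using that by (simp_all add: v_def w_def eig eigs xx xs cinner_quat_flip_flip)
  \<comment> \<open>The \<open>v j\<close> are \<open>q\<close> orthogonal vectors with negative
    values \<open>g j\<close>, and \<open>w i\<close> is orthogonal to all of them.\<close>
  have w_pos: "- 1 - g i > 0" if i: "i < q" and nz: "\<exists>t<?n. w i t \<noteq> 0" for i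
  proof -
    have "Re (?h (w i) (w i)) > 0"
    proof (rule hform_pos_of_orthogonal_negatives[where v = v])
      show "?h (v j) (v l) = 0" if "j < q" "l < q" "j \<noteq> l" for j l using vv that by simp
      show "Re (?h (v j) (v j)) < 0" if "j < q" for j using vv[OF that that] g_le[OF that] by simp
      show "?h (w i) (v j) = 0" if "j < q" for j
        using vw[OF that i] hform_eq_0_commute by blast
    qed (fact nz)
    then show ?thesis using ww[OF i i] by simp
  qed
  \<comment> \<open>The bound -1/2 of the spectral theorem improves to -1: equality holds if
    \<open>w i\<close> vanishes, and otherwise \<open>w i\<close> is positive.\<close>
  have g_le1: "g i \<le> - 1" if i: "i < q" for i
  proof (cases "\<exists>t<?n. w i t \<noteq> 0")
    case True
    then show ?thesis using w_pos[OF i] by simp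
  next
    case False
    then have "?h (w i) (w i) = 0" by (intro hform_zero_left) auto
    then have "of_real (- 1 - g i) = (0 :: complex)" using ww[OF i i] by simp
    then show ?thesis by (simp only: of_real_eq_0_iff)
  qed
  \<comment> \<open>The squares of \<open>sinh\<close> and \<open>cosh\<close> become the value of
    the form on \<open>w i\<close> and minus its value on \<open>v i\<close>.\<close>
  define \<theta> where "\<theta> i = arsinh (sqrt (- 1 - g i))" for i
  have sinh2: "(sinh (\<theta> i))\<^sup>2 = - 1 - g i" and cosh2: "(cosh (\<theta> i))\<^sup>2 = - g i" if "i < q" for i
    using g_le1[OF that] by (simp_all add: \<theta>_def cosh_square_eq)
  \<comment> \<open>Division by \<open>sinh\<close> is possible for these indices. For the other
    \<open>i < q\<close> the vector \<open>w i\<close> is zero, and row \<open>i\<close> of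
    \<open>V\<close> may be any completing vector.\<close>
  define I where "I = {i. i < q \<and> sinh (\<theta> i) \<noteq> 0}"
  have w_zero: "w i t = 0" if "i < q" "i \<notin> I" "t < ?n" for i t
    using w_pos[of i] sinh2[of i] that by (auto simp: I_def)
  define v' where "v' i = (\<lambda>t. v i t / of_real (cosh (\<theta> i)))" for i
  define w' where "w' i = (\<lambda>t. w i t / of_real (sinh (\<theta> i)))" for i
  have v'v': "?h (v' i) (v' j) = (if i = j then - 1 else 0)" if "i < q" "j < q" for i j
  proof -
    have "complex_of_real (g i) = - (of_real (cosh (\<theta> i)) * of_real (cosh (\<theta> i)))"
      using cosh2[OF that(1)] by (metis minus_minus of_real_minus of_real_mult power2_eq_square)
    then show ?thesis
      using that by (auto simp: v'_def hform_divide_left hform_divide_right vv)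
  qed
  have w'w': "?h (w' i) (w' j) = (if i = j then 1 else 0)" if "i \<in> I" "j \<in> I" for i j
  proof -
    have "complex_of_real (- 1 - g i) = of_real (sinh (\<theta> i)) * of_real (sinh (\<theta> i))"
      using sinh2[of i] that by (metis (no_types, lifting) I_def mem_Collect_eq of_real_mult power2_eq_square)
    then show ?thesis
      using that by (auto simp: w'_def hform_divide_left hform_divide_right ww I_def)
  qed
  have w'v': "?h (w' i) (v' j) = 0" if "i \<in> I" "j < q" for i j
    using that vw[of j i] hform_eq_0_commute[of _ _ "w i" "v j"]
    by (auto simp: w'_def v'_def hform_divide_left hform_divide_right I_def)
  have "I \<subseteq> {..<p}" using qp by (auto simp: I_def)
  then have ID: "I \<union> ({..<p} - I) = {..<p}" by blast
  \<comment> \<open>The rows filled in are those from \<open>q\<close> to \<open>p - 1\<close> and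
    those with zero angle.\<close>
  obtain w'' where
    w'': "\<forall>i\<in>I. w'' i = w' i"
      "\<forall>i\<in>{..<p}. \<forall>j\<in>{..<p}. ?h (w'' i) (w'' j) = (if i = j then 1 else 0)"
      "\<forall>i\<in>{..<p}. \<forall>j<q. ?h (w'' i) (v' j) = 0"
    using extend_pseudo_orthonormal_family[of q p v' "{..<p} - I" I w', OF v'v' _ _ _ w'w' w'v']
    unfolding ID by auto
  define r where "r i = (if i < p then w'' i else v' (i - p))" for i
  have rr: "?h (r i) (r j) = (if i = j then of_real (signature_sign p i) else 0)" if "i < ?n" "j < ?n" for i j
    using that w''(2,3) v'v'[of "i - p" "j - p"] hform_eq_0_commute[of _ _ "v' (i - p)" "w'' j"]
    by (auto simp: r_def signature_sign_def)
  define V where "V = mat ?n ?n (\<lambda>(i, t). r i t)"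
  have cV: "V \<in> carrier_mat ?n ?n" by (simp add: V_def)
  have "V * signature_mat p q * mat_adjoint V = signature_mat p q"
  proof (rule eq_matI)
    fix i j assume "i < dim_row (signature_mat p q :: complex mat)" "j < dim_col (signature_mat p q :: complex mat)"
    then have ij: "i < ?n" "j < ?n" by auto
    have "?h (\<lambda>t. V $$ (i, t)) (\<lambda>t. V $$ (j, t)) = ?h (r i) (r j)"
      using ij by (intro hform_cong) (auto simp: V_def)
    then show "(V * signature_mat p q * mat_adjoint V) $$ (i, j) = signature_mat p q $$ (i, j)"
      by (simp add: complex_gram_index[OF cV ij] rr[OF ij] signature_mat_index[OF ij])
  qed (use cV mat_adjoint_carrier[OF cV] in auto)
  then have "mat_adjoint V * signature_mat p q * V = signature_mat p q"
    by (rule pseudo_unitary_swap(1)[OF cV mat_adjoint_carrier[OF cV] signature_mat_carrier signature_mat_square])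
       (erule (2) mat_mult_left_right_inverse)
  then have V: "V \<in> complex_indefinite_unitary p q" using cV by (simp add: complex_indefinite_unitary_def)

  \<comment> \<open>The rows of \<open>X\<close> are the eigenvectors, so multiplication by
    \<open>X\<close> passes to the eigenbasis in the bottom rows of \<open>U\<close>.\<close>
  define X where "X = mat q q (\<lambda>(i, j). quat_row \<eta> q (x i) j)"
  have cX: "X \<in> carrier_mat q q" by (simp add: X_def)
  have XX: "X * quat_adjoint X = 1\<^sub>m q"
  proof (rule eq_matI)
    fix i j assume "i < dim_row (1\<^sub>m q :: quat mat)" "j < dim_col (1\<^sub>m q :: quat mat)"
    then have ij: "i < q" "j < q" by auto
    have "(X * quat_adjoint X) $$ (i, j) = (\<Sum>t<q. quat_row \<eta> q (x i) t * qcnj (quat_row \<eta> q (x j) t))"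
      unfolding index_mat_mult[OF cX quat_adjoint_carrier[OF cX] ij]
      using ij by (intro sum.cong) (auto simp: quat_adjoint_index[OF cX], auto simp: X_def)
    also have "\<dots> = (if i = j then 1 else 0)"
    proof (rule cpart_eta_eqI[OF eta])
      have "cinner (q + q) (quat_flip q (x i)) (x j) = 0"
        using xs[OF ij(2,1)] hform_eq_0_commute by blast
      then show "cpart (\<eta> * (\<Sum>t<q. quat_row \<eta> q (x i) t * qcnj (quat_row \<eta> q (x j) t))) =
          cpart (\<eta> * (if i = j then 1 else 0))"
        by (simp only: cpart_quat_row_inner[OF eta]) (simp add: eta_simps(3)[OF eta])
      show "cpart (\<Sum>t<q. quat_row \<eta> q (x i) t * qcnj (quat_row \<eta> q (x j) t)) =
          cpart (if i = j then 1 else 0)"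
        by (simp only: cpart_quat_row_inner[OF eta] xx[OF ij]) simp
    qed
    finally show "(X * quat_adjoint X) $$ (i, j) = 1\<^sub>m q $$ (i, j)" using ij by simp
  qed (use cX in \<open>auto simp: quat_adjoint_def\<close>)
  have X: "X \<in> quat_unitary q" "quat_adjoint X \<in> quat_unitary q"
    using quat_mat_mult_left_right_inverse[OF cX quat_adjoint_carrier[OF cX] XX] XX cX
    by (simp_all add: quat_unitary_def)

  let ?H = "hyperbolic_mat p q \<eta> \<theta>" and ?V = "map_mat quat_of_complex V"
  let ?bd = "\<lambda>A B :: quat mat. four_block_mat A (0\<^sub>m p q) (0\<^sub>m q p) B"
  \<comment> \<open>\<open>N\<close> is the right part of the decomposition and \<open>N'\<close>
    below is its inverse; it remains to identify the left factor \<open>U * N'\<close>.\<close>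
  define N where "N = ?H * ?V"
  have N: "N \<in> quat_indefinite_unitary p q" unfolding N_def
    by (intro quat_indefinite_unitary_mult hyperbolic_mat_pseudo_unitary eta qp map_quat_of_complex_indefinite_unitary V)
  define N' where "N' = signature_mat p q * quat_adjoint N * signature_mat p q"
  have N': "N' \<in> quat_indefinite_unitary p q" unfolding N'_def by (rule quat_indefinite_unitary_inverse[OF N])
  have NN': "N' * N = 1\<^sub>m ?n" "N * N' = 1\<^sub>m ?n"
    unfolding N'_def by (fact quat_indefinite_unitaryD(4)[OF N] quat_indefinite_unitaryD(5)[OF N])+
  note cN = quat_indefinite_unitaryD(1)[OF N] quat_indefinite_unitaryD(1)[OF N']
  define L where "L = ?bd (1\<^sub>m p) X"
  have one: "1\<^sub>m p \<in> quat_unitary p"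
  proof -
    have "quat_adjoint (1\<^sub>m p) = 1\<^sub>m p" by (rule eq_matI) (auto simp: quat_adjoint_def)
    then show ?thesis by (simp add: quat_unitary_def)
  qed
  have L: "L \<in> quat_indefinite_unitary p q"
    unfolding L_def by (rule four_block_diag_indefinite_unitary[OF one X(1)])
  note cL = quat_indefinite_unitaryD(1)[OF L]
  have LU: "(L * U) $$ (p + i, t) = N $$ (p + i, t)" if "i < q" "t < ?n" for i t
  proof -
    have c: "?V \<in> carrier_mat ?n ?n" using cV by simp
    have "(L * U) $$ (p + i, t) = (\<Sum>j<q. quat_row \<eta> q (x i) j * W j t)"
      using that by (subst index_mat_mult[OF cL cU])
        (auto simp: sum_lessThan_add L_def cX carrier_matD[OF cX] W_def, auto simp: X_def)
    also have "\<dots> = quat_of_complex (v i t) - \<eta> * quat_of_complex (w i t)"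
      unfolding row_combination_decomp[OF eta] v_def w_def \<alpha>_def ..
    also have "v i t = of_real (cosh (\<theta> i)) * V $$ (p + i, t)"
      using that by (simp add: V_def r_def v'_def)
    also have "w i t = of_real (sinh (\<theta> i)) * V $$ (i, t)"
    proof (cases "i \<in> I")
      case True
      then show ?thesis using that qp w''(1) by (auto simp: V_def r_def w'_def I_def)
    next
      case False
      then show ?thesis using that w_zero by (auto simp: I_def)
    qed
    also have "quat_of_complex (of_real (cosh (\<theta> i)) * V $$ (p + i, t)) -
        \<eta> * quat_of_complex (of_real (sinh (\<theta> i)) * V $$ (i, t)) = N $$ (p + i, t)"
      unfolding N_def hyperbolic_mult_row_index(2)[OF qp c that(2,1)]
      using that qp cV by (simp add: quat_of_complex_simps mult_of_real_left_commute mult.assoc)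
    finally show ?thesis .
  qed
  \<comment> \<open>Since \<open>L * U\<close> and \<open>N\<close> agree in the bottom rows,
    multiplying by the inverse of \<open>N\<close> leaves bottom rows of the identity.\<close>
  define G where "G = L * (U * N')"
  have G: "G \<in> quat_indefinite_unitary p q"
    unfolding G_def by (intro quat_indefinite_unitary_mult L U N')
  have "\<exists>A \<in> quat_unitary p. G = ?bd A (1\<^sub>m q)"
  proof (rule quat_indefinite_unitary_block_diag[OF G])
    fix i t assume it: "i < q" "t < ?n"
    have "G = (L * U) * N'" unfolding G_def by (rule assoc_mult_mat[OF cL cU cN(2), symmetric])
    then have "G $$ (p + i, t) = (\<Sum>l<?n. N $$ (p + i, l) * N' $$ (l, t))"
      using it by (simp add: index_mat_mult[OF mult_carrier_mat[OF cL cU] cN(2)] LU)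
    also have "\<dots> = (N * N') $$ (p + i, t)"
      using it by (simp add: index_mat_mult[OF cN])
    finally show "G $$ (p + i, t) = (if t = p + i then 1 else 0)"
      using it by (auto simp: NN')
  qed
  then obtain A where A: "A \<in> quat_unitary p" and GA: "G = ?bd A (1\<^sub>m q)" by blast
  have cA: "A \<in> carrier_mat p p" using A by (simp add: quat_unitary_def)
  have cUN: "U * N' \<in> carrier_mat ?n ?n" by (rule mult_carrier_mat[OF cU cN(2)])
  \<comment> \<open>Undoing \<open>L\<close> puts \<open>quat_adjoint X\<close> into the lower
    block; this is \<open>Uq\<close>, and \<open>A\<close> is \<open>Up\<close>.\<close>
  define L' where "L' = ?bd (1\<^sub>m p) (quat_adjoint X)"
  have cL': "L' \<in> carrier_mat ?n ?n" using X(2) by (simp add: L'_def quat_unitary_def)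
  have "L' * L = ?bd (1\<^sub>m p * 1\<^sub>m p) (quat_adjoint X * X)"
    unfolding L_def L'_def by (rule mult_four_block_diag[OF one_carrier_mat one_carrier_mat quat_adjoint_carrier[OF cX] cX])
  also have "\<dots> = 1\<^sub>m ?n" using X(1) by (simp add: quat_unitary_def)
  finally have L'L: "L' * L = 1\<^sub>m ?n" .
  have "L' * G = (L' * L) * (U * N')"
    unfolding G_def by (rule assoc_mult_mat[OF cL' cL cUN, symmetric])
  also have "\<dots> = U * N'" unfolding L'L by (rule left_mult_one_mat[OF cUN])
  finally have "U * N' = ?bd A (quat_adjoint X)"
    unfolding GA L'_def mult_four_block_diag[OF one_carrier_mat cA quat_adjoint_carrier[OF cX] one_carrier_mat]
      left_mult_one_mat[OF cA] right_mult_one_mat[OF quat_adjoint_carrier[OF cX]] by simp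
  then have "?bd A (quat_adjoint X) * N = U * N' * N" by simp
  also have "\<dots> = U * (N' * N)" by (rule assoc_mult_mat[OF cU cN(2,1)])
  also have "\<dots> = U" unfolding NN' by (rule right_mult_one_mat[OF cU])
  finally have "U = ?bd A (quat_adjoint X) * N" ..
  also have "\<dots> = ?bd A (quat_adjoint X) * ?H * ?V"
    unfolding N_def
    by (rule assoc_mult_mat[symmetric, OF four_block_carrier_mat[OF cA quat_adjoint_carrier[OF cX]]
          hyperbolic_mat_carrier[OF qp]]) (use cV in simp)
  finally show ?thesis using A X(2) V by blast
qed

section \<open>Existence, with uniqueness up to order and signs\<close>

theorem theorem7p11:
  fixes n p q :: nat and \<eta> :: quat and U :: "quat mat"
  assumes "n = p + q" and "p \<ge> q"
    and "\<eta> \<in> {quat_j, quat_k}"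
    and "U \<in> carrier_mat n n" and "U \<in> quat_indefinite_unitary p q"
  shows "\<exists>\<theta> :: nat \<Rightarrow> real.
    (\<exists>Up \<in> quat_unitary p. \<exists>Uq \<in> quat_unitary q. \<exists>V \<in> complex_indefinite_unitary p q.
      U = four_block_mat Up (0\<^sub>m p q) (0\<^sub>m q p) Uq * hyperbolic_mat p q \<eta> \<theta>
            * map_mat quat_of_complex V) \<and>
    (\<forall>\<theta>' :: nat \<Rightarrow> real.
      (\<exists>Up \<in> quat_unitary p. \<exists>Uq \<in> quat_unitary q. \<exists>V \<in> complex_indefinite_unitary p q.
        U = four_block_mat Up (0\<^sub>m p q) (0\<^sub>m q p) Uq * hyperbolic_mat p q \<eta> \<theta>'
              * map_mat quat_of_complex V) \<longrightarrow>
      (\<exists>\<pi> s. \<pi> permutes {..<q} \<and>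
        (\<forall>i<q. s i \<in> {1, - 1} \<and> \<theta>' i = s i * \<theta> (\<pi> i))))"
proof -
  obtain \<theta> Up Uq V where Up: "Up \<in> quat_unitary p" and Uq: "Uq \<in> quat_unitary q"
    and V: "V \<in> complex_indefinite_unitary p q"
    and U: "U = four_block_mat Up (0\<^sub>m p q) (0\<^sub>m q p) Uq * hyperbolic_mat p q \<eta> \<theta> * map_mat quat_of_complex V"
    using quat_indefinite_unitary_decomposition[OF assms(3,2,5)] by blast
  have "\<exists>\<pi> s. \<pi> permutes {..<q} \<and> (\<forall>i<q. s i \<in> {1, - 1} \<and> \<theta>' i = s i * \<theta> (\<pi> i))"
    if Up': "Up' \<in> quat_unitary p" and Uq': "Uq' \<in> quat_unitary q"
      and V': "V' \<in> complex_indefinite_unitary p q"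
      and U': "U = four_block_mat Up' (0\<^sub>m p q) (0\<^sub>m q p) Uq' * hyperbolic_mat p q \<eta> \<theta>'
        * map_mat quat_of_complex V'" for \<theta>' Up' Uq' V'
  proof -
    obtain \<pi> where \<pi>: "\<pi> permutes {..<q}" "\<forall>i<q. \<bar>\<theta>' i\<bar> = \<bar>\<theta> (\<pi> i)\<bar>"
      using hyperbolic_angles_unique[OF assms(3,2) four_block_diag_unitary[OF Up Uq] V U
          four_block_diag_unitary[OF Up' Uq'] V' U'] by blast
    \<comment> \<open>Equal absolute values leave a choice of sign: 1 where the angles coincide,
      which includes zero angles, and -1 otherwise.\<close>
    then show ?thesis
      by (intro exI[of _ \<pi>] exI[of _ "\<lambda>i. if \<theta>' i = \<theta> (\<pi> i) then 1 else - 1"])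
         (auto simp: abs_eq_iff)
  qed
  with Up Uq V U show ?thesis by blast
qed

end
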